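(* For every $n\ge 1$, the size $G_n$ of the greedy independent set on a uniform Cayley tree $\mathcal{T}_n$ of size $n$ has the same law as the number $H_n$ of vertices at even height in $\mathcal{T}_n^{\bullet}$, the tree $\mathcal{T}_n$ rooted at a uniformly chosen vertex. As a consequence, for $1\le k\le n-1$, $$\mathbb{P}(G_n=k)=\mathbb{P}(H_n=k)=\binom{n}{k}\frac{k^{n-k}(n-k)^{k-1}}{n^{n-1}}.$$
   Context: A Cayley tree of size $n$ is an unrooted, unordered tree on the labeled vertex set $\{1,\dots,n\}$ (there are $n^{n-2}$ of them); $\mathcal{T}_n$ is a uniformly random one. $\mathcal{T}_n^{\bullet}$ is the rooted tree obtained from $\mathcal{T}_n$ by distinguishing (as root) a vertex chosen uniformly at random in $\{1,\dots,n\}$, independently of $\mathcal{T}_n$. The height of a vertex in a rooted tree is its graph distance to the root (so the root has height $0$, which is even). $H_n$ is the number of vertices of $\mathcal{T}_n^{\bullet}$ at even height. Greedy independent set of a finite graph with vertex set $V$: vertices have one of three statuses, undetermined ($\mathcal{U}_k$), active ($\mathcal{A}_k$), blocked ($\mathcal{B}_k$). Initially $\mathcal{U}_0=V$, $\mathcal{A}_0=\mathcal{B}_0=\emptyset$. At each step $k\ge 1$, an undetermined vertex $v_k$ is chosen uniformly at random among the currently undetermined vertices (given the graph and the past choices), its status is changed to active, and the status of all its undetermined neighbours is changed to blocked. The procedure stops at $\tau=\min\{k\ge 0:\mathcal{U}_k=\emptyset\}$, and $\mathcal{A}_\tau$ is the greedy independent set. $G_n$ is $|\mathcal{A}_\tau|$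 when the graph is the random tree $\mathcal{T}_n$. *)

theory Defs
  imports "HOL-Probability.Probability_Mass_Function"
begin

text \<open>A finite simple graph is given by a vertex set \<open>V\<close> and its adjacency relation \<open>E\<close>.
  Since \<open>E\<close> is symmetric and irreflexive, each labelled graph corresponds to exactly one \<open>E\<close>.\<close>

definition simple_graph :: "'a set \<Rightarrow> 'a rel \<Rightarrow> bool" where
  "simple_graph V E \<longleftrightarrow> finite V \<and> E \<subseteq> V \<times> V \<and> sym E \<and> irrefl E"

definition connected_graph :: "'a set \<Rightarrow> 'a rel \<Rightarrow> bool" where
  "connected_graph V E \<longleftrightarrow> V \<noteq> {} \<and> (\<forall>u\<in>V. \<forall>v\<in>V. (u, v) \<in> E\<^sup>*)"

definition is_cycle :: "'a rel \<Rightarrow> 'a list \<Rightarrow> bool" where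
  "is_cycle E c \<longleftrightarrow> length c \<ge> 3 \<and> distinct c \<and>
     (\<forall>i<length c. (c ! i, c ! (Suc i mod length c)) \<in> E)"

definition is_tree :: "'a set \<Rightarrow> 'a rel \<Rightarrow> bool" where
  "is_tree V E \<longleftrightarrow> simple_graph V E \<and> connected_graph V E \<and> (\<nexists>c. is_cycle E c)"

text \<open>\<open>(u, v) \<in> E ^^ k\<close> says that there is a walk with \<open>k\<close> edges from \<open>u\<close> to \<open>v\<close>.\<close>

definition graph_dist :: "'a rel \<Rightarrow> 'a \<Rightarrow> 'a \<Rightarrow> nat" where
  "graph_dist E u v = (LEAST k. (u, v) \<in> E ^^ k)"

definition cayley_trees :: "nat \<Rightarrow> nat rel set" where
  "cayley_trees n = {E. is_tree {1..n} E}"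

lemma finite_cayley_trees: "finite (cayley_trees n)"
proof (rule finite_subset)
  show "cayley_trees n \<subseteq> Pow ({1..n} \<times> {1..n})"
    by (auto simp: cayley_trees_def is_tree_def simple_graph_def)
qed simp

lemma cayley_trees_nonempty:
  assumes "n \<ge> 1"
  shows "cayley_trees n \<noteq> {}"
proof -
  define E where "E = {1::nat} \<times> {2..n} \<union> {2..n} \<times> {1}"
  have "simple_graph {1..n} E"
    using assms by (auto simp: simple_graph_def E_def sym_def irrefl_def)
  moreover have "connected_graph {1..n} E"
  proof -
    have 1: "(1, v) \<in> E\<^sup>*" "(v, 1) \<in> E\<^sup>*" if "v \<in> {1..n}" for v
      using that by (cases "v = 1"; force simp: E_def)+
    show ?thesis
      unfolding connected_graph_def using assms 1(2)[THEN rtrancl_trans, OF _ 1(1)] by simp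
  qed
  moreover have "\<not> is_cycle E c" for c
  proof
    assume "is_cycle E c"
    then have len: "length c \<ge> 3" and dist: "distinct c"
      and e: "\<And>i. i < length c \<Longrightarrow> (c ! i, c ! (Suc i mod length c)) \<in> E"
      by (auto simp: is_cycle_def)
    have "c \<noteq> []" using len by auto
    then have e0: "(c ! 0, c ! 1) \<in> E" and e1: "(c ! 1, c ! 2) \<in> E"
      using e[of 0] e[of 1] len by (auto simp: numeral_2_eq_2)
    have ne: "c ! 0 \<noteq> c ! 2" "c ! 1 \<noteq> c ! 2"
      using nth_eq_iff_index_eq[OF dist, of 0 2] nth_eq_iff_index_eq[OF dist, of 1 2] len
      by linarith+
    have c1: "c ! 1 = 1" using e0 e1 ne by (auto simp: E_def)
    then have "c ! (3 mod length c) = c ! 1"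
      using e[of 2] len ne by (auto simp: E_def numeral_3_eq_3 numeral_2_eq_2)
    then have "3 mod length c = 1"
      using nth_eq_iff_index_eq[OF dist, of "3 mod length c" 1] len
        mod_less_divisor[of "length c" 3] by linarith
    then show False using len by (cases "length c = 3") auto
  qed
  ultimately have "E \<in> cayley_trees n"
    by (auto simp: cayley_trees_def is_tree_def)
  then show ?thesis by blast
qed

definition random_cayley_tree :: "nat \<Rightarrow> nat rel pmf" where
  "random_cayley_tree n = pmf_of_set (cayley_trees n)"

definition random_rooted_cayley_tree :: "nat \<Rightarrow> (nat rel \<times> nat) pmf" where
  "random_rooted_cayley_tree n = pair_pmf (random_cayley_tree n) (pmf_of_set {1..n})"

definition H_law :: "nat \<Rightarrow> nat pmf" where
  "H_law n = map_pmf (\<lambda>(E, r). card {v \<in> {1..n}. even (graph_dist E r v)})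
     (random_rooted_cayley_tree n)"

text \<open>\<open>greedy_run E U A B\<close> is the law of the final active set when the procedure is continued
  from the undetermined set \<open>U\<close>, the active set \<open>A\<close> and the blocked set \<open>B\<close>. The case of an
  infinite \<open>U\<close> is a dummy which makes the function total.\<close>

function greedy_run :: "'a rel \<Rightarrow> 'a set \<Rightarrow> 'a set \<Rightarrow> 'a set \<Rightarrow> 'a set pmf" where
  "greedy_run E U A B =
     (if U = {} \<or> infinite U then return_pmf A
      else pmf_of_set U \<bind> (\<lambda>v.
        let N = {w \<in> U - {v}. (v, w) \<in> E}
        in greedy_run E (U - {v} - N) (insert v A) (B \<union> N)))"
  by pat_completeness auto
termination
proof (relation "Wellfounded.measure (\<lambda>(E, U, A, B). card U)", goal_cases)
  case (2 E U A B v N)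
  then have "finite U" "v \<in> U" by auto
  then show ?case by (auto intro!: psubset_card_mono)
qed simp

declare greedy_run.simps [simp del]

definition greedy_independent_set :: "'a set \<Rightarrow> 'a rel \<Rightarrow> 'a set pmf" where
  "greedy_independent_set V E = greedy_run E V {} {}"

definition G_law :: "nat \<Rightarrow> nat pmf" where
  "G_law n = random_cayley_tree n \<bind> (\<lambda>E. map_pmf card (greedy_independent_set {1..n} E))"

end

theory Submission
  imports Defs "HOL-Combinatorics.Transposition"
begin

text \<open>Root a Cayley tree at a vertex \<open>v\<close> and record it by its parent map; deleting the root leaves
a forest whose roots are the first layer \<open>N\<close>. So the natural objects are the forests on
disjoint sets \<open>U\<close> and \<open>B\<close> in which every vertex of \<open>U\<close> has a parent and the roots are the elements
of \<open>B\<close>. The theorem follows from an identity about a uniformly random such forest: the greedy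
procedure on the graph induced on \<open>U\<close> (where \<open>B\<close> is thought of as already blocked) produces a set
whose size has the law of the number of vertices at odd height. Both laws are given by the same
closed formula \<open>forest_number\<close>, and each is found by removing one piece of the forest.

Heights: if \<open>N\<close> is the set of children of the roots, then what remains is an arbitrary forest on
\<open>U - N\<close> with root set \<open>N\<close>, in which every height has dropped by one, so that odd and even are
exchanged (\<open>sum_rooted_forests_by_layer\<close>, \<open>card_rooted_forests_odd_height\<close>).

Greedy procedure: activate \<open>v \<in> U\<close> and block its set \<open>N\<close> of neighbours in \<open>U\<close>. As far as the graph
induced on \<open>U' = U - {v} - N\<close> is concerned, what remains is a uniform forest on \<open>U'\<close> with root set
\<open>B \<union> N\<close>, with a multiplicity that depends only on cardinalities (\<open>sum_forests_nbrs\<close>). If the parent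
of \<open>v\<close> lies in \<open>B\<close>, this is clear. Otherwise the parent of \<open>v\<close> is some \<open>p \<in> N\<close>, and the parent of
\<open>p\<close> may be any vertex whose root in the remaining forest lies in \<open>B\<close>. The number of these vertices
depends on the forest, but exchanging two roots does not change the graph induced on \<open>U'\<close>, so that
on average every root carries the same share of the vertices (\<open>sum_card_root_in\<close>). Summing over \<open>N\<close>
gives a recursion which the closed formula satisfies (\<open>sum_greedy_size_prob_forests\<close>).

For the tree itself, let \<open>v\<close> be the first active vertex, and root the tree at \<open>v\<close>. The remaining
graph is induced by the forest above the first layer, so the number of further active vertices has
the law of the number of its vertices at odd height, and these are the vertices of the tree at
nonzero even height. As \<open>v\<close> is uniform, this is the law of the number of vertices at even height,
the root \<open>v\<close> included. The formula for the probabilities is \<open>forest_number\<close> divided by Cayley's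
number of trees, which the decomposition by layers also provides.\<close>

section \<open>Rooted forests as parent maps\<close>

text \<open>The last condition is acyclicity: iterating the parent map cannot stay inside \<open>U\<close> forever. Closed
sets instead of iterates make it immediate that acyclicity passes to subforests, and give induction
along the parent map (\<open>forest_induct\<close>). Being the identity off \<open>U\<close> makes the map unique and lets
the iterates stop at the roots.\<close>

definition rooted_forests :: "'a set \<Rightarrow> 'a set \<Rightarrow> ('a \<Rightarrow> 'a) set" where
  "rooted_forests U B =
     {f. (\<forall>x\<in>U. f x \<in> U \<union> B) \<and> (\<forall>x. x \<notin> U \<longrightarrow> f x = x) \<and>
         (\<forall>X\<subseteq>U. f ` X \<subseteq> X \<longrightarrow> X = {})}"

lemma rooted_forestsI:
  assumes "\<And>x. x \<in> U \<Longrightarrow> f x \<in> U \<union> B" "\<And>x. x \<notin> U \<Longrightarrow> f x = x"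
    and "\<And>X. X \<subseteq> U \<Longrightarrow> f ` X \<subseteq> X \<Longrightarrow> X = {}"
  shows "f \<in> rooted_forests U B"
  using assms by (auto simp: rooted_forests_def)

lemma rooted_forestsD:
  assumes "f \<in> rooted_forests U B"
  shows "x \<in> U \<Longrightarrow> f x \<in> U \<union> B" "x \<notin> U \<Longrightarrow> f x = x"
    and "X \<subseteq> U \<Longrightarrow> f ` X \<subseteq> X \<Longrightarrow> X = {}"
  using assms by (auto simp: rooted_forests_def)

lemma parent_neq:
  assumes "f \<in> rooted_forests U B" "x \<in> U"
  shows "f x \<noteq> x"
  using rooted_forestsD(3)[OF assms(1), of "{x}"] assms(2) by auto

lemma grandparent_neq:
  assumes "f \<in> rooted_forests U B" "x \<in> U" "f x \<in> U"
  shows "f (f x) \<noteq> x"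
  using rooted_forestsD(3)[OF assms(1), of "{x, f x}"] assms(2,3) by auto

lemma forest_induct [consumes 2, case_names root child]:
  assumes f: "f \<in> rooted_forests U B" and x: "x \<in> U \<union> B"
    and root: "\<And>x. x \<in> B \<Longrightarrow> P x"
    and child: "\<And>x. x \<in> U \<Longrightarrow> f x \<in> U \<union> B \<Longrightarrow> P (f x) \<Longrightarrow> P x"
  shows "P x"
proof -
  have "{x \<in> U. \<not> P x} = {}"
    using rooted_forestsD(1)[OF f] root child
    by (intro rooted_forestsD(3)[OF f]) blast+
  with x root show ?thesis by blast
qed

lemma finite_rooted_forests:
  assumes "finite U" "finite B"
  shows "finite (rooted_forests U B)"
proof (rule inj_on_finite[where f = "\<lambda>f. restrict f U"])
  show "inj_on (\<lambda>f. restrict f U) (rooted_forests U B)"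
  proof (rule inj_onI, rule ext)
    fix f g x assume fg: "f \<in> rooted_forests U B" "g \<in> rooted_forests U B"
      "restrict f U = restrict g U"
    show "f x = g x"
      using fun_cong[OF fg(3), of x] rooted_forestsD(2)[OF fg(1), of x]
        rooted_forestsD(2)[OF fg(2), of x] by (cases "x \<in> U") auto
  qed
  show "(\<lambda>f. restrict f U) ` rooted_forests U B \<subseteq> U \<rightarrow>\<^sub>E (U \<union> B)"
    by (auto simp: rooted_forests_def)
  show "finite (U \<rightarrow>\<^sub>E (U \<union> B))" using assms by (intro finite_PiE) auto
qed

lemma rooted_forests_empty [simp]: "rooted_forests {} B = {\<lambda>x. x}"
  by (auto simp: rooted_forests_def)

lemma rooted_forests_no_roots: "U \<noteq> {} \<Longrightarrow> rooted_forests U {} = {}"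
  by (auto simp: rooted_forests_def)

definition height :: "('a \<Rightarrow> 'a) \<Rightarrow> 'a set \<Rightarrow> 'a \<Rightarrow> nat" where
  "height f B x = (LEAST k. (f ^^ k) x \<in> B)"

definition root_of :: "('a \<Rightarrow> 'a) \<Rightarrow> 'a set \<Rightarrow> 'a \<Rightarrow> 'a" where
  "root_of f B x = (f ^^ height f B x) x"

lemma height_root [simp]: "x \<in> B \<Longrightarrow> height f B x = 0"
  by (simp add: height_def)

lemma root_of_root [simp]: "x \<in> B \<Longrightarrow> root_of f B x = x"
  by (simp add: root_of_def)

context
  fixes f :: "'a \<Rightarrow> 'a" and U B :: "'a set"
  assumes f: "f \<in> rooted_forests U B" and disj: "U \<inter> B = {}"
begin

lemma reaches_root:
  assumes "x \<in> U \<union> B" shows "\<exists>k. (f ^^ k) x \<in> B"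
  using f assms
proof (induction x rule: forest_induct)
  case (root x)
  then show ?case by (intro exI[of _ 0]) simp
next
  case (child x)
  then obtain k where "(f ^^ k) (f x) \<in> B" by blast
  then show ?case by (intro exI[of _ "Suc k"]) (simp add: funpow_swap1)
qed

lemma height_parent:
  assumes "x \<in> U" shows "height f B x = Suc (height f B (f x))"
proof -
  obtain k where "(f ^^ k) x \<in> B" using reaches_root assms by blast
  moreover have "(f ^^ 0) x \<notin> B" using assms disj by auto
  ultimately have "(LEAST k. (f ^^ k) x \<in> B) = Suc (LEAST k. (f ^^ Suc k) x \<in> B)"
    by (rule Least_Suc)
  then show ?thesis by (simp add: height_def funpow_swap1)
qed

lemma root_of_parent:
  assumes "x \<in> U" shows "root_of f B x = root_of f B (f x)"
  by (simp add: root_of_def height_parent[OF assms] funpow_swap1)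

lemma root_of_in:
  assumes "x \<in> U \<union> B" shows "root_of f B x \<in> B"
  using f assms
  by (induction x rule: forest_induct) (auto simp: root_of_parent)

end

definition prune :: "('a \<Rightarrow> 'a) \<Rightarrow> 'a set \<Rightarrow> 'a \<Rightarrow> 'a" where
  "prune f S = (\<lambda>x. if x \<in> S then f x else x)"

lemma prune_in_rooted_forests:
  assumes f: "f \<in> rooted_forests U B" and "S \<subseteq> U" and "\<And>x. x \<in> S \<Longrightarrow> f x \<in> S \<union> B'"
  shows "prune f S \<in> rooted_forests S B'"
proof (rule rooted_forestsI)
  fix X assume X: "X \<subseteq> S" "prune f S ` X \<subseteq> X"
  then have "f ` X \<subseteq> X" by (auto simp: prune_def image_subset_iff split: if_splits)
  then show "X = {}" using rooted_forestsD(3)[OF f, of X] X(1) assms(2) by auto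
qed (use assms(3) in \<open>auto simp: prune_def\<close>)

definition layer :: "('a \<Rightarrow> 'a) \<Rightarrow> 'a set \<Rightarrow> 'a set \<Rightarrow> 'a set" where
  "layer f U B = {x \<in> U. f x \<in> B}"

lemma prune_layer_in_rooted_forests:
  assumes f: "f \<in> rooted_forests U B"
  shows "prune f (U - layer f U B) \<in> rooted_forests (U - layer f U B) (layer f U B)"
  using rooted_forestsD(1)[OF f] by (intro prune_in_rooted_forests[OF f]) (auto simp: layer_def)

text \<open>A forest amounts to its first layer \<open>N\<close>, an arbitrary map from \<open>N\<close> to the roots, and an arbitrary
forest on the other vertices with root set \<open>N\<close>. This is the engine of all recursions on height.\<close>

lemma sum_rooted_forests_by_layer:
  fixes \<Phi> :: "'a set \<Rightarrow> ('a \<Rightarrow> 'a) \<Rightarrow> 'b :: comm_semiring_1"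
  assumes fin: "finite U" "finite B" and disj: "U \<inter> B = {}"
  shows "(\<Sum>f\<in>rooted_forests U B. \<Phi> (layer f U B) (prune f (U - layer f U B))) =
         (\<Sum>N\<in>Pow U. of_nat (card B ^ card N) * (\<Sum>g\<in>rooted_forests (U - N) N. \<Phi> N g))"
proof -
  have "(\<Sum>f\<in>{f \<in> rooted_forests U B. layer f U B = N}.
          \<Phi> (layer f U B) (prune f (U - layer f U B))) =
      of_nat (card B ^ card N) * (\<Sum>g\<in>rooted_forests (U - N) N. \<Phi> N g)"
    if N: "N \<subseteq> U" for N
  proof -
    let ?glue = "\<lambda>(\<phi>, g) x. if x \<in> N then \<phi> x else g x"
    have "(\<Sum>f\<in>{f \<in> rooted_forests U B. layer f U B = N}.
             \<Phi> (layer f U B) (prune f (U - layer f U B))) =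
        (\<Sum>(\<phi>, g)\<in>(N \<rightarrow>\<^sub>E B) \<times> rooted_forests (U - N) N. \<Phi> N g)"
    proof (rule sum.reindex_bij_witness[where i = ?glue and
          j = "\<lambda>f. (restrict f N, prune f (U - N))"])
      fix f assume "f \<in> {f \<in> rooted_forests U B. layer f U B = N}"
      then have f: "f \<in> rooted_forests U B" and Nf: "layer f U B = N" by auto
      show "?glue (restrict f N, prune f (U - N)) = f"
        using N rooted_forestsD(2)[OF f] by (auto simp: prune_def fun_eq_iff)
      show "(restrict f N, prune f (U - N)) \<in> (N \<rightarrow>\<^sub>E B) \<times> rooted_forests (U - N) N"
        using prune_layer_in_rooted_forests[OF f] Nf by (auto simp: layer_def)
      show "(\<lambda>(\<phi>, g). \<Phi> N g) (restrict f N, prune f (U - N)) =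
          \<Phi> (layer f U B) (prune f (U - layer f U B))"
        using Nf by simp
    next
      fix z assume "z \<in> (N \<rightarrow>\<^sub>E B) \<times> rooted_forests (U - N) N"
      then obtain \<phi> g where z: "z = (\<phi>, g)" and \<phi>: "\<phi> \<in> N \<rightarrow>\<^sub>E B"
        and g: "g \<in> rooted_forests (U - N) N" by auto
      let ?f = "\<lambda>x. if x \<in> N then \<phi> x else g x"
      have gU: "g x \<in> U" if "x \<in> U" "x \<notin> N" for x
        using rooted_forestsD(1)[OF g, of x] that N by auto
      have \<phi>B: "\<phi> x \<in> B" if "x \<in> N" for x using \<phi> that by auto
      have lay: "layer ?f U B = N" using \<phi>B gU N disj by (auto simp: layer_def)
      have "?f \<in> rooted_forests U B"
      proof (rule rooted_forestsI)
        fix X assume X: "X \<subseteq> U" "?f ` X \<subseteq> X"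
        have "x \<notin> N" if "x \<in> X" for x
        proof
          assume "x \<in> N"
          then have "\<phi> x \<in> X" using X(2) that by (auto simp: image_subset_iff)
          then show False using \<phi>B[OF \<open>x \<in> N\<close>] X(1) disj by auto
        qed
        then have XN: "X \<inter> N = {}" by auto
        have "g ` X \<subseteq> X" using X XN by (auto simp: image_subset_iff)
        then show "X = {}" using rooted_forestsD(3)[OF g, of X] X(1) XN by auto
      qed (use \<phi>B gU N rooted_forestsD(2)[OF g] in auto)
      with lay show "?glue z \<in> {f \<in> rooted_forests U B. layer f U B = N}" using z by simp
      have "restrict ?f N = \<phi>" using \<phi> by (auto simp: PiE_def extensional_def)
      moreover have "prune ?f (U - N) = g"
        using rooted_forestsD(2)[OF g] by (auto simp: prune_def fun_eq_iff)
      ultimately show "(restrict (?glue z) N, prune (?glue z) (U - N)) = z"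
        unfolding z by (simp only: prod.case)
    qed
    also have "\<dots> = of_nat (card (N \<rightarrow>\<^sub>E B)) * (\<Sum>g\<in>rooted_forests (U - N) N. \<Phi> N g)"
      by (simp add: sum.cartesian_product[symmetric])
    also have "card (N \<rightarrow>\<^sub>E B) = card B ^ card N"
      using N fin(1) by (simp add: card_PiE finite_subset)
    finally show ?thesis .
  qed
  moreover have "(\<Sum>f\<in>rooted_forests U B. \<Phi> (layer f U B) (prune f (U - layer f U B))) =
      (\<Sum>N\<in>Pow U. \<Sum>f\<in>{f \<in> rooted_forests U B. layer f U B = N}.
         \<Phi> (layer f U B) (prune f (U - layer f U B)))"
    using fin by (intro sum.group[symmetric] finite_rooted_forests) (auto simp: layer_def)
  ultimately show ?thesis by simp
qed

section \<open>Counting forests by the parity of heights\<close>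

lemma sum_Pow_by_card:
  fixes F :: "nat \<Rightarrow> 'a :: comm_semiring_1"
  assumes "finite A"
  shows "(\<Sum>S\<in>Pow A. F (card S)) = (\<Sum>i\<le>card A. of_nat (card A choose i) * F i)"
proof -
  have "(\<Sum>S\<in>Pow A. F (card S)) = (\<Sum>i\<le>card A. \<Sum>S\<in>{S \<in> Pow A. card S = i}. F (card S))"
    using assms by (intro sum.group[symmetric]) (auto intro: card_mono)
  also have "\<dots> = (\<Sum>i\<le>card A. of_nat (card {S. S \<subseteq> A \<and> card S = i}) * F i)"
    by (intro sum.cong refl) (simp add: Pow_def)
  finally show ?thesis using assms by (simp add: n_subsets)
qed

lemma binomial_first_moment:
  fixes a c :: "'a :: comm_semiring_1"
  shows "(\<Sum>i\<le>m. of_nat i * (of_nat (m choose i) * a ^ i * c ^ (m - i))) =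
     of_nat m * a * (a + c) ^ (m - 1)"
proof (cases m)
  case (Suc p)
  have "of_nat (Suc i) * (of_nat (Suc p choose Suc i) * a ^ Suc i * c ^ (Suc p - Suc i)) =
      of_nat (Suc p) * a * (of_nat (p choose i) * a ^ i * c ^ (p - i))" for i
  proof -
    have "(of_nat (Suc i * (Suc p choose Suc i)) :: 'a) = of_nat (Suc p * (p choose i))"
      by (simp only: Suc_times_binomial)
    then have "(of_nat (Suc i) * of_nat (Suc p choose Suc i) :: 'a) =
        of_nat (Suc p) * of_nat (p choose i)" by (simp only: of_nat_mult)
    then show ?thesis
      by (simp only: mult.assoc[symmetric]) (simp only: power_Suc mult_ac diff_Suc_Suc)
  qed
  then have "(\<Sum>i\<le>Suc p. of_nat i * (of_nat (Suc p choose i) * a ^ i * c ^ (Suc p - i))) =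
      (\<Sum>i\<le>p. of_nat (Suc p) * a * (of_nat (p choose i) * a ^ i * c ^ (p - i)))"
    by (subst sum.atMost_Suc_shift) simp
  also have "\<dots> = of_nat (Suc p) * a * (a + c) ^ p"
    by (simp only: sum_distrib_left[symmetric] binomial_ring)
  finally show ?thesis using Suc by simp
qed simp

text \<open>The weighted form of Cayley's formula. With \<open>u = card U\<close> and \<open>b = card B\<close>, the decomposition by
layers gives the sum of \<open>(u choose i) b\<^sup>i (i u\<^bsup>u - i - 1\<^esup>)\<close> by induction; multiplied by \<open>u\<close>,
it is the first moment of the binomial expansion of \<open>(b + u)\<^sup>u\<close>.\<close>

lemma card_rooted_forests:
  assumes "finite U" "finite B" "U \<inter> B = {}" "U \<noteq> {}"
  shows "card (rooted_forests U B) = card B * (card U + card B) ^ (card U - 1)"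
  using assms
proof (induction "card U" arbitrary: U B rule: less_induct)
  case less
  define u where "u = card U"
  \<comment> \<open>the claimed number of forests on \<open>u - i\<close> vertices with \<open>i\<close> roots; the case \<open>i = u\<close> is the empty forest\<close>
  define T where "T i = (if i = u then 1 else i * u ^ (u - i - 1))" for i
  have u: "u > 0" using less.prems by (auto simp: u_def)
  have T: "card (rooted_forests (U - N) N) = T (card N)" if "N \<subseteq> U" for N
  proof -
    have fN: "finite N" using that less.prems(1) finite_subset by blast
    consider "N = {}" | "N = U" | "N \<noteq> {}" "N \<subset> U" using \<open>N \<subseteq> U\<close> by blast
    then show ?thesis
    proof cases
      case 1
      then show ?thesis using less.prems u by (simp add: T_def rooted_forests_no_roots)
    next
      case 2
      then show ?thesis by (simp add: T_def u_def)
    next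
      case 3
      have lt: "card N < u" using psubset_card_mono[OF less.prems(1) 3(2)] by (simp add: u_def)
      have c: "card (U - N) = u - card N" using that fN by (simp add: card_Diff_subset u_def)
      have "0 < card N" using 3 fN by (simp add: card_gt_0_iff)
      then show ?thesis
        using less.hyps[of "U - N" N] less.prems(1) fN 3 lt c by (auto simp: T_def u_def)
    qed
  qed
  have "card (rooted_forests U B) = (\<Sum>f\<in>rooted_forests U B. 1)" by simp
  also have "\<dots> = (\<Sum>N\<in>Pow U. card B ^ card N * card (rooted_forests (U - N) N))"
    using sum_rooted_forests_by_layer[OF less.prems(1-3), of "\<lambda>_ _. 1 :: nat"] by simp
  also have "\<dots> = (\<Sum>N\<in>Pow U. card B ^ card N * T (card N))"
    using T by (intro sum.cong) auto
  also have "\<dots> = (\<Sum>i\<le>u. (u choose i) * (card B ^ i * T i))"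
    using sum_Pow_by_card[OF less.prems(1), of "\<lambda>i. card B ^ i * T i"] by (simp add: u_def)
  finally have "u * card (rooted_forests U B) = (\<Sum>i\<le>u. u * ((u choose i) * (card B ^ i * T i)))"
    by (simp add: sum_distrib_left)
  also have "\<dots> = (\<Sum>i\<le>u. i * ((u choose i) * card B ^ i * u ^ (u - i)))"
  proof (rule sum.cong[OF refl])
    fix i assume "i \<in> {..u}"
    then have "u * T i = i * u ^ (u - i)"
      by (cases "i = u") (auto simp: T_def power_eq_if)
    then have "(u choose i) * card B ^ i * (u * T i) = (u choose i) * card B ^ i * (i * u ^ (u - i))"
      by simp
    then show "u * ((u choose i) * (card B ^ i * T i)) =
        i * ((u choose i) * card B ^ i * u ^ (u - i))" by (simp add: algebra_simps)
  qed
  also have "\<dots> = u * (card B * (card B + u) ^ (u - 1))"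
    using binomial_first_moment[of u "card B" u] by simp
  finally show ?case using u by (simp add: u_def add.commute)
qed

definition odd_height_count :: "('a \<Rightarrow> 'a) \<Rightarrow> 'a set \<Rightarrow> 'a set \<Rightarrow> nat" where
  "odd_height_count f U B = card {x \<in> U. odd (height f B x)}"

text \<open>Above the first layer all heights drop by one, and the first layer itself is at odd height: the
vertices at odd height are those that are not at odd height in the pruned forest.\<close>

lemma odd_height_count_prune_layer:
  assumes f: "f \<in> rooted_forests U B" and "finite U" and disj: "U \<inter> B = {}"
  defines "N \<equiv> layer f U B"
  shows "odd_height_count f U B + odd_height_count (prune f (U - N)) (U - N) N = card U"
proof -
  let ?g = "prune f (U - N)"
  have g: "?g \<in> rooted_forests (U - N) N"
    unfolding N_def by (rule prune_layer_in_rooted_forests[OF f])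
  have NU: "N \<subseteq> U" and dj: "(U - N) \<inter> N = {}" by (auto simp: N_def layer_def)
  have h: "height f B x = Suc (height ?g N x)" if "x \<in> (U - N) \<union> N" for x
    using g that
  proof (induction x rule: forest_induct)
    case (root x)
    then show ?case using height_parent[OF f disj, of x] by (auto simp: N_def layer_def)
  next
    case (child x)
    then show ?case
      using height_parent[OF f disj, of x] height_parent[OF g dj child.hyps(1)] by (auto simp: prune_def)
  qed
  have "{x \<in> U. odd (height f B x)} = U - {x \<in> U - N. odd (height ?g N x)}"
    using h NU by fastforce
  moreover have "card (U - {x \<in> U - N. odd (height ?g N x)}) + card {x \<in> U - N. odd (height ?g N x)}
      = card U"
    using \<open>finite U\<close> by (subst card_Diff_subset) (auto intro!: diff_add_inverse2 le_add_diff_inverse2 card_mono)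
  ultimately show ?thesis by (simp add: odd_height_count_def)
qed

text \<open>The number of forests with \<open>u\<close> non-roots and \<open>b\<close> roots in which exactly \<open>k\<close> vertices have odd height.
After the choice of these vertices, it counts the spanning forests of the complete bipartite graph
with parts of sizes \<open>k\<close> and \<open>u + b - k\<close> that are rooted at \<open>b\<close> given vertices of the second part.
For \<open>k = 0\<close> only the empty forest remains, because children of roots have odd height.\<close>

definition forest_number :: "nat \<Rightarrow> nat \<Rightarrow> nat \<Rightarrow> nat" where
  "forest_number u b k =
     (if k = 0 then of_bool (u = 0)
      else (u choose k) * b * (u + b - k) ^ (k - 1) * k ^ (u - k))"

lemma forest_number_no_roots [simp]: "u > 0 \<Longrightarrow> forest_number u 0 k = 0"
  by (simp add: forest_number_def)

text \<open>The recursion by layers. The numbers of odd and even non-roots \<open>k\<close> and \<open>u - k\<close> change places, and the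
\<open>i\<close> vertices of the first layer must be among the \<open>k\<close> odd ones.\<close>

lemma forest_number_rec:
  assumes "u \<ge> 1" "k \<le> u"
  shows "(\<Sum>i\<le>u. (u choose i) * (b ^ i * forest_number (u - i) i (u - k))) = forest_number u b k"
proof -
  consider "k = u" | "k = 0" | "0 < k" "k < u" using assms by linarith
  then show ?thesis
  proof cases
    case 1
    have "(\<Sum>i\<le>u. (u choose i) * (b ^ i * forest_number (u - i) i (u - k))) =
        (\<Sum>i\<le>u. if i = u then b ^ u else 0)"
      using 1 by (intro sum.cong) (auto simp: forest_number_def)
    also have "\<dots> = b ^ u" by simp
    finally show ?thesis using 1 assms by (simp add: forest_number_def power_eq_if)
  next
    case 2
    then have "forest_number (u - i) i (u - k) = 0" if "i \<le> u" for i
      using assms that by (cases "i = 0") (auto simp: forest_number_def)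
    then show ?thesis using 2 assms by (simp add: forest_number_def)
  next
    case 3
    define m where "m = u - k"
    have m: "m > 0" "u = k + m" using 3 by (auto simp: m_def)
    have "(u choose i) * (b ^ i * forest_number (u - i) i m) =
        (u choose k) * k ^ (m - 1) * (i * ((k choose i) * b ^ i * m ^ (k - i)))"
      if "i \<le> u" for i
    proof (cases "i \<le> k")
      case True
      have "(u choose k) * (k choose i) = (u choose i) * ((u - i) choose (k - i))"
        using True 3 by (intro choose_mult) auto
      also have "(u - i) choose (k - i) = (u - i) choose m"
        using True m by (subst binomial_symmetric) auto
      finally have c: "(u choose i) * ((u - i) choose m) = (u choose k) * (k choose i)" ..
      have "forest_number (u - i) i m = ((u - i) choose m) * i * k ^ (m - 1) * m ^ (k - i)"
        using m True by (simp add: forest_number_def)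
      then have "(u choose i) * (b ^ i * forest_number (u - i) i m) =
          ((u choose i) * ((u - i) choose m)) * (b ^ i * i * k ^ (m - 1) * m ^ (k - i))"
        by (simp add: algebra_simps)
      then show ?thesis unfolding c by (simp add: algebra_simps)
    next
      case False
      then have "u - i < m" using m by linarith
      then show ?thesis using m False by (simp add: forest_number_def binomial_eq_0)
    qed
    then have "(\<Sum>i\<le>u. (u choose i) * (b ^ i * forest_number (u - i) i m)) =
        (\<Sum>i\<le>u. (u choose k) * k ^ (m - 1) * (i * ((k choose i) * b ^ i * m ^ (k - i))))"
      by (intro sum.cong) auto
    also have "\<dots> = (u choose k) * k ^ (m - 1) * (\<Sum>i\<le>u. i * ((k choose i) * b ^ i * m ^ (k - i)))"
      by (simp add: sum_distrib_left)
    also have "(\<Sum>i\<le>u. i * ((k choose i) * b ^ i * m ^ (k - i))) =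
        (\<Sum>i\<le>k. i * ((k choose i) * b ^ i * m ^ (k - i)))"
      using m by (intro sum.mono_neutral_right) auto
    also have "\<dots> = k * b * (b + m) ^ (k - 1)"
      using binomial_first_moment[of k b m] by simp
    also have "(u choose k) * k ^ (m - 1) * (k * b * (b + m) ^ (k - 1)) =
        (u choose k) * b * (b + m) ^ (k - 1) * (k * k ^ (m - 1))"
      by (simp add: algebra_simps)
    also have "k * k ^ (m - 1) = k ^ m" using m by (simp add: power_eq_if)
    also have "(u choose k) * b * (b + m) ^ (k - 1) * k ^ m = forest_number u b k"
      using 3(1) m(2) by (simp add: forest_number_def add.commute)
    finally show ?thesis by (simp only: m_def)
  qed
qed

lemma card_rooted_forests_odd_height:
  assumes "finite U" "finite B" "U \<inter> B = {}"
  shows "card {f \<in> rooted_forests U B. odd_height_count f U B = k} = forest_number (card U) (card B) k"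
  using assms
proof (induction "card U" arbitrary: U B k rule: less_induct)
  case less
  define u where "u = card U"
  define b where "b = card B"
  have fin: "finite (rooted_forests U' B')" if "U' \<subseteq> U" "finite B'" for U' B'
    using that less.prems finite_subset by (intro finite_rooted_forests) auto
  show ?case
  proof (cases "U = {}")
    case True
    then show ?thesis by (auto simp: odd_height_count_def forest_number_def)
  next
    case False
    then have u: "u \<ge> 1" using less.prems(1) by (simp add: u_def Suc_le_eq card_gt_0_iff)
    show ?thesis
    proof (cases "k \<le> u")
      case False
      have "odd_height_count f U B \<noteq> k" for f
        using False card_mono[OF less.prems(1), of "{x \<in> U. odd (height f B x)}"]
        by (auto simp: odd_height_count_def u_def)
      then show ?thesis using False by (simp add: forest_number_def u_def)
    next
      case True
      let ?\<Phi> = "\<lambda>N g. of_bool (odd_height_count g (U - N) N = u - k) :: nat"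
      have "card {f \<in> rooted_forests U B. odd_height_count f U B = k} =
          (\<Sum>f\<in>rooted_forests U B. of_bool (odd_height_count f U B = k))"
        using fin[of U B] less.prems by (simp add: Int_def)
      also have "\<dots> = (\<Sum>f\<in>rooted_forests U B. ?\<Phi> (layer f U B) (prune f (U - layer f U B)))"
        using odd_height_count_prune_layer[OF _ less.prems(1,3)] True
        by (intro sum.cong refl) (fastforce simp: u_def intro: arg_cong[where f = of_bool])
      also have "\<dots> = (\<Sum>N\<in>Pow U. b ^ card N * (\<Sum>g\<in>rooted_forests (U - N) N. ?\<Phi> N g))"
        using sum_rooted_forests_by_layer[OF less.prems, of ?\<Phi>] by (simp add: b_def)
      also have "\<dots> = (\<Sum>N\<in>Pow U. b ^ card N * forest_number (u - card N) (card N) (u - k))"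
      proof (rule sum.cong[OF refl])
        fix N assume "N \<in> Pow U"
        then have N: "N \<subseteq> U" "finite N" using less.prems(1) finite_subset by auto
        have c: "card (U - N) = u - card N" using N by (simp add: card_Diff_subset u_def)
        have "(\<Sum>g\<in>rooted_forests (U - N) N. ?\<Phi> N g) =
            card {g \<in> rooted_forests (U - N) N. odd_height_count g (U - N) N = u - k}"
          using fin[of "U - N" N] N by (simp add: Int_def)
        also have "\<dots> = forest_number (u - card N) (card N) (u - k)"
        proof (cases "N = {}")
          case True
          then show ?thesis using False u by (simp add: rooted_forests_no_roots)
        next
          case False
          then have "card (U - N) < card U"
            using N less.prems(1) by (intro psubset_card_mono) auto
          then show ?thesis using less.hyps[of "U - N" N "u - k"] N less.prems(1) c by auto
        qed
        finally show "b ^ card N * (\<Sum>g\<in>rooted_forests (U - N) N. ?\<Phi> N g) =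
            b ^ card N * forest_number (u - card N) (card N) (u - k)" by simp
      qed
      also have "\<dots> = (\<Sum>i\<le>u. (u choose i) * (b ^ i * forest_number (u - i) i (u - k)))"
        using sum_Pow_by_card[OF less.prems(1), of "\<lambda>i. b ^ i * forest_number (u - i) i (u - k)"]
        by (simp add: u_def)
      also have "\<dots> = forest_number u b k" by (rule forest_number_rec[OF u True])
      finally show ?thesis by (simp add: u_def b_def)
    qed
  qed
qed

section \<open>The size of the greedy independent set\<close>

text \<open>The probability that the greedy procedure on the subgraph induced on \<open>U\<close> takes \<open>k\<close> steps. At
\<open>U = {}\<close> the second equation is an empty sum, hence \<open>0\<close>.\<close>

primrec greedy_size_prob :: "'a rel \<Rightarrow> nat \<Rightarrow> 'a set \<Rightarrow> real" where
  "greedy_size_prob E 0 U = of_bool (U = {})"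
| "greedy_size_prob E (Suc k) U =
     (\<Sum>v\<in>U. greedy_size_prob E k (U - {v} - {w \<in> U - {v}. (v, w) \<in> E})) / real (card U)"

text \<open>Each step makes one more vertex active. The statement covers all intermediate states, since the
induction over the run passes through them.\<close>

lemma pmf_card_greedy_run:
  assumes "finite U" "finite A" "A \<inter> U = {}"
  shows "pmf (map_pmf card (greedy_run E U A B)) m =
    (if m < card A then 0 else greedy_size_prob E (m - card A) U)"
  using assms
proof (induction "card U" arbitrary: U A B rule: less_induct)
  case less
  show ?case
  proof (cases "U = {}")
    case True
    then show ?thesis
      by (subst greedy_run.simps) (cases "m - card A", auto simp: pmf_return)
  next
    case False
    let ?N = "\<lambda>v. {w \<in> U - {v}. (v, w) \<in> E}"
    have "pmf (map_pmf card (greedy_run E (U - {v} - ?N v) (insert v A) (B \<union> ?N v))) m =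
        (if m < Suc (card A) then 0 else greedy_size_prob E (m - Suc (card A)) (U - {v} - ?N v))"
      if v: "v \<in> U" for v
    proof -
      have "card (insert v A) = Suc (card A)" using v less.prems(2,3) by (intro card_insert_disjoint) auto
      moreover have "card (U - {v} - ?N v) < card U"
        using v less.prems(1) by (intro psubset_card_mono) auto
      then have "pmf (map_pmf card (greedy_run E (U - {v} - ?N v) (insert v A) (B \<union> ?N v))) m =
          (if m < card (insert v A) then 0
           else greedy_size_prob E (m - card (insert v A)) (U - {v} - ?N v))"
        by (rule less.hyps) (use less.prems in auto)
      ultimately show ?thesis by (simp only:)
    qed
    moreover have "greedy_run E U A B =
        pmf_of_set U \<bind> (\<lambda>v. greedy_run E (U - {v} - ?N v) (insert v A) (B \<union> ?N v))"
      using False less.prems(1) by (subst greedy_run.simps) (simp add: Let_def)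
    ultimately have "pmf (map_pmf card (greedy_run E U A B)) m =
        (\<Sum>v\<in>U. if m < Suc (card A) then 0
              else greedy_size_prob E (m - Suc (card A)) (U - {v} - ?N v)) / real (card U)"
      using False less.prems(1) by (simp add: map_bind_pmf pmf_bind_pmf_of_set)
    also have "\<dots> = (if m < card A then 0 else greedy_size_prob E (m - card A) U)"
    proof (cases "m \<le> card A")
      case True
      then show ?thesis using False by (cases "m = card A") auto
    next
      case False
      then obtain j where "m = Suc (card A + j)"
        using less_imp_Suc_add[of "card A" m] by auto
      then show ?thesis by simp
    qed
    finally show ?thesis .
  qed
qed

text \<open>What happens inside the undetermined set does not depend on the edges that leave it. This is what
allows the forest to be replaced by another one with the same induced graph.\<close>

lemma greedy_size_prob_cong:
  assumes "E \<inter> (U \<times> U) = E' \<inter> (U \<times> U)"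
  shows "greedy_size_prob E k U = greedy_size_prob E' k U"
  using assms
proof (induction k arbitrary: U)
  case (Suc k)
  have "greedy_size_prob E k (U - {v} - {w \<in> U - {v}. (v, w) \<in> E}) =
        greedy_size_prob E' k (U - {v} - {w \<in> U - {v}. (v, w) \<in> E'})" if "v \<in> U" for v
  proof -
    have "{w \<in> U - {v}. (v, w) \<in> E} = {w \<in> U - {v}. (v, w) \<in> E'}"
      using that Suc.prems by blast
    moreover have "greedy_size_prob E k V = greedy_size_prob E' k V" if "V \<subseteq> U" for V
      using that Suc.prems by (intro Suc.IH) blast
    ultimately show ?thesis by (metis (no_types, lifting) Diff_subset order_trans)
  qed
  then show ?case by simp
qed simp

section \<open>Exchanging the roots of a forest\<close>

definition forest_edges :: "('a \<Rightarrow> 'a) \<Rightarrow> 'a set \<Rightarrow> 'a rel" where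
  "forest_edges f U = {(x, f x) | x. x \<in> U} \<union> {(f x, x) | x. x \<in> U}"

lemma forest_edges_within:
  "forest_edges f U \<inter> V \<times> V = {(x, y). x \<in> V \<and> y \<in> V \<and> (x \<in> U \<and> f x = y \<or> y \<in> U \<and> f y = x)}"
  by (auto simp: forest_edges_def)

text \<open>Exchanging the children of \<open>\<beta>\<close> with those of \<open>\<gamma>\<close> is an involution on the forests. It preserves the
graph induced on \<open>U\<close>, hence the weight \<open>\<Psi>\<close>, and it exchanges the trees of the two roots.\<close>

lemma sum_root_symmetric:
  fixes \<Psi> :: "('a \<Rightarrow> 'a) \<Rightarrow> real"
  assumes fin: "finite U" "finite R" and disj: "U \<inter> R = {}"
    and \<Psi>: "\<And>g g'. forest_edges g U \<inter> U \<times> U = forest_edges g' U \<inter> U \<times> U \<Longrightarrow> \<Psi> g = \<Psi> g'"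
    and \<beta>: "\<beta> \<in> R" "\<gamma> \<in> R"
  shows "(\<Sum>g\<in>rooted_forests U R. \<Psi> g * real (card {w \<in> U \<union> R. root_of g R w = \<beta>})) =
         (\<Sum>g\<in>rooted_forests U R. \<Psi> g * real (card {w \<in> U \<union> R. root_of g R w = \<gamma>}))"
proof -
  let ?t = "Transposition.transpose \<beta> \<gamma>"
  let ?s = "\<lambda>g x. if x \<in> U then ?t (g x) else x"
  have t_U: "?t x = x" if "x \<in> U" for x
    using that disj \<beta> by (auto simp: Transposition.transpose_def)
  have t_R: "?t x \<in> R \<longleftrightarrow> x \<in> R" for x
    using \<beta> by (auto simp: Transposition.transpose_def)
  have s_eq: "?s g x = y \<longleftrightarrow> g x = y" if "x \<in> U" "y \<in> U" for g x y
    using that \<beta> disj by (auto simp: Transposition.transpose_def)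
  have s_in: "?s g \<in> rooted_forests U R" if g: "g \<in> rooted_forests U R" for g
  proof (rule rooted_forestsI)
    fix X assume X: "X \<subseteq> U" "?s g ` X \<subseteq> X"
    have "g x \<in> X" if "x \<in> X" for x
    proof -
      have "?s g x \<in> X" using X that by blast
      then show ?thesis using s_eq[of x "?s g x" g] X that by auto
    qed
    then show "X = {}" using rooted_forestsD(3)[OF g, of X] X(1) by auto
  next
    fix x assume "x \<in> U"
    then show "?s g x \<in> U \<union> R" using rooted_forestsD(1)[OF g, of x] t_U[of "g x"] t_R by (cases "g x \<in> U") auto
  qed simp
  have s_s: "?s (?s g) = g" if "g \<in> rooted_forests U R" for g
    using rooted_forestsD(2)[OF that] by (auto simp: fun_eq_iff)
  have s_root: "root_of (?s g) R x = ?t (root_of g R x)"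
    if g: "g \<in> rooted_forests U R" and x: "x \<in> U" for g x
  proof -
    have "x \<in> U \<longrightarrow> root_of (?s g) R x = ?t (root_of g R x)"
      using g UnI1[OF x]
    proof (induction x rule: forest_induct)
      case (root x)
      then show ?case using disj by auto
    next
      case (child x)
      have a: "root_of (?s g) R x = root_of (?s g) R (?s g x)"
        using root_of_parent[OF s_in[OF g] disj child.hyps(1)] .
      have b: "root_of g R x = root_of g R (g x)"
        using root_of_parent[OF g disj child.hyps(1)] .
      show ?case
      proof (cases "g x \<in> U")
        case True
        then show ?thesis using a b child t_U by simp
      next
        case False
        then have "g x \<in> R" using child.hyps(2) by auto
        then show ?thesis using a b child.hyps(1) t_R by simp
      qed
    qed
    then show ?thesis using x by simp
  qed
  have split: "{w \<in> U \<union> R. root_of g R w = r} = insert r {w \<in> U. root_of g R w = r}"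
    if "r \<in> R" for r g using that by auto
  have card_split: "card {w \<in> U \<union> R. root_of g R w = r} = Suc (card {w \<in> U. root_of g R w = r})"
    if "r \<in> R" for r g
    unfolding split[OF that] using that fin disj by (subst card_insert_disjoint) auto
  have card_s: "card {w \<in> U \<union> R. root_of (?s g) R w = \<gamma>} = card {w \<in> U \<union> R. root_of g R w = \<beta>}"
    if g: "g \<in> rooted_forests U R" for g
  proof -
    have "{w \<in> U. root_of (?s g) R w = \<gamma>} = {w \<in> U. root_of g R w = \<beta>}"
      using s_root[OF g] by (auto simp: Transposition.transpose_eq_iff)
    then show ?thesis using card_split \<beta> by simp
  qed
  have \<Psi>_s: "\<Psi> (?s g) = \<Psi> g" for g
    using s_eq
    by (intro \<Psi>) (simp only: forest_edges_within cong: conj_cong)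
  show ?thesis
  proof (rule sum.reindex_bij_witness[where i = ?s and j = ?s])
    fix g assume g: "g \<in> rooted_forests U R"
    show "?s (?s g) = g" "?s (?s g) = g" by (rule s_s[OF g])+
    show "?s g \<in> rooted_forests U R" "?s g \<in> rooted_forests U R" by (rule s_in[OF g])+
    show "\<Psi> (?s g) * real (card {w \<in> U \<union> R. root_of (?s g) R w = \<gamma>}) =
        \<Psi> g * real (card {w \<in> U \<union> R. root_of g R w = \<beta>})"
      by (simp only: card_s[OF g] \<Psi>_s)
  qed
qed

text \<open>By symmetry, the roots in \<open>B\<close> carry on average the fraction \<open>card B / card R\<close> of all vertices.\<close>

lemma sum_card_root_in:
  fixes \<Psi> :: "('a \<Rightarrow> 'a) \<Rightarrow> real"
  assumes fin: "finite U" "finite R" and disj: "U \<inter> R = {}" and "B \<subseteq> R"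
    and \<Psi>: "\<And>g g'. forest_edges g U \<inter> U \<times> U = forest_edges g' U \<inter> U \<times> U \<Longrightarrow> \<Psi> g = \<Psi> g'"
  shows "real (card R) * (\<Sum>g\<in>rooted_forests U R. \<Psi> g * real (card {w \<in> U \<union> R. root_of g R w \<in> B})) =
         real (card B) * (real (card (U \<union> R)) * (\<Sum>g\<in>rooted_forests U R. \<Psi> g))"
proof (cases "R = {}")
  case True
  then show ?thesis using assms(4) by simp
next
  case False
  then obtain \<rho> where \<rho>: "\<rho> \<in> R" by blast
  define z where "z = (\<Sum>g\<in>rooted_forests U R. \<Psi> g * real (card {w \<in> U \<union> R. root_of g R w = \<rho>}))"
  have *: "(\<Sum>g\<in>rooted_forests U R. \<Psi> g * real (card {w \<in> U \<union> R. root_of g R w \<in> C})) = real (card C) * z"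
    if C: "C \<subseteq> R" for C
  proof -
    have fC: "finite C" using C fin finite_subset by blast
    have "card {w \<in> U \<union> R. root_of g R w \<in> C} = (\<Sum>\<beta>\<in>C. card {w \<in> U \<union> R. root_of g R w = \<beta>})" for g
    proof -
      have "{w \<in> U \<union> R. root_of g R w \<in> C} = (\<Union>\<beta>\<in>C. {w \<in> U \<union> R. root_of g R w = \<beta>})" by auto
      then show ?thesis using fin fC by (simp only:) (subst card_UN_disjoint, auto)
    qed
    then have "(\<Sum>g\<in>rooted_forests U R. \<Psi> g * real (card {w \<in> U \<union> R. root_of g R w \<in> C})) =
        (\<Sum>g\<in>rooted_forests U R. \<Sum>\<beta>\<in>C. \<Psi> g * real (card {w \<in> U \<union> R. root_of g R w = \<beta>}))"
      by (simp add: sum_distrib_left)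
    also have "\<dots> = (\<Sum>\<beta>\<in>C. \<Sum>g\<in>rooted_forests U R. \<Psi> g * real (card {w \<in> U \<union> R. root_of g R w = \<beta>}))"
      by (rule sum.swap)
    also have "\<dots> = (\<Sum>\<beta>\<in>C. z)"
      unfolding z_def using C \<rho> by (intro sum.cong refl sum_root_symmetric[OF fin disj \<Psi>]) auto
    finally show ?thesis by simp
  qed
  have "{w \<in> U \<union> R. root_of g R w \<in> R} = U \<union> R" if "g \<in> rooted_forests U R" for g
    using root_of_in[OF that disj] by auto
  then have "real (card (U \<union> R)) * (\<Sum>g\<in>rooted_forests U R. \<Psi> g) =
      (\<Sum>g\<in>rooted_forests U R. \<Psi> g * real (card {w \<in> U \<union> R. root_of g R w \<in> R}))"
    unfolding sum_distrib_left by (intro sum.cong refl) (simp add: mult.commute)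
  then show ?thesis using *[of R] *[OF assms(4)] by simp
qed

section \<open>One greedy step on a random forest\<close>

definition forest_nbrs :: "('a \<Rightarrow> 'a) \<Rightarrow> 'a set \<Rightarrow> 'a \<Rightarrow> 'a set" where
  "forest_nbrs f U v = {w \<in> U - {v}. (v, w) \<in> forest_edges f U}"

lemma forest_nbrs_altdef:
  "v \<in> U \<Longrightarrow> forest_nbrs f U v = {w \<in> U - {v}. f w = v \<or> f v = w}"
  by (auto simp: forest_nbrs_def forest_edges_def)

context
  fixes U B :: "'a set" and v :: 'a and N U' :: "'a set" and \<Psi> :: "('a \<Rightarrow> 'a) \<Rightarrow> real"
  assumes fin: "finite U" "finite B" and disj: "U \<inter> B = {}"
    and v: "v \<in> U" and N: "N \<subseteq> U - {v}"
    and U': "U' = U - {v} - N"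
begin

text \<open>If the parent of \<open>v\<close> is a root, then \<open>N\<close> is the set of children of \<open>v\<close>. The parent in \<open>B\<close> is free, and
so is the forest on \<open>U'\<close> with roots \<open>B \<union> N\<close>.\<close>

lemma sum_forests_parent_root:
  "(\<Sum>f\<in>{f \<in> rooted_forests U B. forest_nbrs f U v = N \<and> f v \<in> B}. \<Psi> (prune f U')) =
     real (card B) * (\<Sum>g\<in>rooted_forests U' (B \<union> N). \<Psi> g)"
proof -
  let ?F = "{f \<in> rooted_forests U B. forest_nbrs f U v = N \<and> f v \<in> B}"
  let ?graft = "\<lambda>(\<beta>, g) x. if x = v then \<beta> else if x \<in> N then v else g x"
  have "(\<Sum>f\<in>?F. \<Psi> (prune f U')) = (\<Sum>(\<beta>, g)\<in>B \<times> rooted_forests U' (B \<union> N). \<Psi> g)"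
  proof (rule sum.reindex_bij_witness[where i = ?graft and j = "\<lambda>f. (f v, prune f U')"])
    fix f assume "f \<in> ?F"
    then have f: "f \<in> rooted_forests U B" and Nf: "{w \<in> U - {v}. f w = v \<or> f v = w} = N"
      and fv: "f v \<in> B" using v by (auto simp: forest_nbrs_altdef)
    have Nv: "f x = v" if "x \<in> N" for x
      using Nf that fv disj by fastforce
    have nv: "f x \<noteq> v" if "x \<in> U'" for x using Nf that by (auto simp: U')
    show "?graft (f v, prune f U') = f"
      using Nv rooted_forestsD(2)[OF f] by (auto simp: prune_def fun_eq_iff U')
    have "prune f U' \<in> rooted_forests U' (B \<union> N)"
      by (rule prune_in_rooted_forests[OF f])
        (use nv rooted_forestsD(1)[OF f] in \<open>auto simp: U'\<close>)
    then show "(f v, prune f U') \<in> B \<times> rooted_forests U' (B \<union> N)" using fv by auto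
    show "(\<lambda>(\<beta>, g). \<Psi> g) (f v, prune f U') = \<Psi> (prune f U')" by simp
  next
    fix z assume "z \<in> B \<times> rooted_forests U' (B \<union> N)"
    then obtain \<beta> g where z: "z = (\<beta>, g)" and \<beta>: "\<beta> \<in> B"
      and g: "g \<in> rooted_forests U' (B \<union> N)" by auto
    let ?f = "\<lambda>x. if x = v then \<beta> else if x \<in> N then v else g x"
    have gU: "g x \<in> U \<union> B" "g x \<noteq> v" if "x \<in> U'" for x
      using rooted_forestsD(1)[OF g that] N v disj by (auto simp: U')
    have "?f \<in> rooted_forests U B"
    proof (rule rooted_forestsI)
      fix X assume X: "X \<subseteq> U" "?f ` X \<subseteq> X"
      then have X2: "?f x \<in> X" if "x \<in> X" for x using that by blast
      have "v \<notin> X" using X2[of v] \<beta> disj X(1) by auto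
      moreover from this have "x \<notin> N" if "x \<in> X" for x using X2[OF that] N that by (auto split: if_splits)
      ultimately have XU: "X \<subseteq> U'" using X(1) by (auto simp: U')
      have "g ` X \<subseteq> X"
      proof (intro image_subsetI)
        fix x assume "x \<in> X"
        then show "g x \<in> X" using X2[of x] subsetD[OF XU, of x] by (auto simp: U')
      qed
      then show "X = {}" using rooted_forestsD(3)[OF g XU] by blast
    next
      fix x assume "x \<in> U"
      then show "?f x \<in> U \<union> B" using gU(1)[of x] \<beta> v by (auto simp: U')
    next
      fix x assume "x \<notin> U"
      then show "?f x = x" using rooted_forestsD(2)[OF g, of x] N v by (auto simp: U')
    qed
    moreover have "{w \<in> U - {v}. ?f w = v \<or> ?f v = w} = N"
      using gU(2) N \<beta> disj by (auto simp: U')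
    ultimately show "?graft z \<in> ?F" using \<beta> v by (simp add: z forest_nbrs_altdef)
    have "prune ?f U' = g"
      using rooted_forestsD(2)[OF g] by (auto simp: prune_def fun_eq_iff U')
    then show "((?graft z) v, prune (?graft z) U') = z" by (simp add: z)
  qed
  then show ?thesis by (simp add: sum.cartesian_product[symmetric])
qed

text \<open>If the parent \<open>p\<close> of \<open>v\<close> is not a root, then \<open>N\<close> consists of \<open>p\<close> and the children of \<open>v\<close>. Besides
\<open>p \<in> N\<close> and the forest \<open>g\<close> on \<open>U'\<close>, the parent \<open>w\<close> of \<open>p\<close> has to be chosen. It must not be a
descendant of \<open>v\<close> or \<open>p\<close>, and since all of \<open>N\<close> hangs together through \<open>v\<close>, this says that the
root of \<open>w\<close> in \<open>g\<close> lies in \<open>B\<close>.\<close>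

lemma sum_forests_parent_nonroot:
  "(\<Sum>f\<in>{f \<in> rooted_forests U B. forest_nbrs f U v = N \<and> f v \<in> U}. \<Psi> (prune f U')) =
     real (card N) * (\<Sum>g\<in>rooted_forests U' (B \<union> N).
       \<Psi> g * real (card {w \<in> U' \<union> (B \<union> N). root_of g (B \<union> N) w \<in> B}))"
proof -
  let ?R = "B \<union> N"
  let ?F = "{f \<in> rooted_forests U B. forest_nbrs f U v = N \<and> f v \<in> U}"
  let ?W = "\<lambda>g. {w \<in> U' \<union> ?R. root_of g ?R w \<in> B}"
  let ?G = "SIGMA g : rooted_forests U' ?R. N \<times> ?W g"
  let ?graft = "\<lambda>(g, p, w) x. if x = v then p else if x = p then w else if x \<in> N then v else g x"
  have dj: "U' \<inter> ?R = {}" using disj by (auto simp: U')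
  have NB: "x \<notin> B" if "x \<in> N" for x using that N disj by auto
  have vR: "v \<notin> ?R" "v \<notin> U'" using v N disj by (auto simp: U')
  have "(\<Sum>f\<in>?F. \<Psi> (prune f U')) = (\<Sum>(g, q)\<in>?G. \<Psi> g)"
  proof (rule sum.reindex_bij_witness[where i = ?graft and
        j = "\<lambda>f. (prune f U', f v, f (f v))"])
    fix f assume "f \<in> ?F"
    then have f: "f \<in> rooted_forests U B" and Nf: "{w \<in> U - {v}. f w = v \<or> f v = w} = N"
      and fv: "f v \<in> U" using v by (auto simp: forest_nbrs_altdef)
    have pN: "f v \<in> N" using Nf fv parent_neq[OF f v] by auto
    have Nv: "f x = v" if "x \<in> N" "x \<noteq> f v" for x
      using Nf that by auto
    have nv: "f x \<noteq> v" if "x \<in> U'" for x using Nf that by (auto simp: U')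
    show "?graft (prune f U', f v, f (f v)) = f"
      using Nv rooted_forestsD(2)[OF f] by (auto simp: prune_def fun_eq_iff U')
    have g: "prune f U' \<in> rooted_forests U' ?R"
      by (rule prune_in_rooted_forests[OF f])
        (use nv rooted_forestsD(1)[OF f] in \<open>auto simp: U'\<close>)
    let ?g = "prune f U'"
    define w where "w = f (f v)"
    have "w \<noteq> v" using grandparent_neq[OF f v fv] by (simp add: w_def)
    moreover have "w \<notin> N"
    proof
      assume "w \<in> N"
      moreover have "w \<noteq> f v" using parent_neq[OF f fv] by (simp add: w_def)
      ultimately have "f w = v" "w \<in> U" using Nv N by auto
      then have "{v, f v, w} = {}"
        using v fv by (intro rooted_forestsD(3)[OF f]) (auto simp: w_def)
      then show False by simp
    qed
    moreover have "w \<in> U \<union> B" using rooted_forestsD(1)[OF f fv] by (simp add: w_def)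
    ultimately have w: "w \<in> U' \<union> B" by (auto simp: U')
    have "root_of ?g ?R w \<in> B"
    proof (rule ccontr)
      assume nB: "root_of ?g ?R w \<notin> B"
      \<comment> \<open>the component of \<open>v\<close> would be closed under the parent map and would not contain a root\<close>
      let ?X = "{x \<in> U'. root_of ?g ?R x \<notin> B} \<union> N \<union> {v}"
      have "f x \<in> ?X" if x: "x \<in> ?X" for x
      proof -
        consider "x = v" | "x = f v" "x \<noteq> v" | "x \<in> N" "x \<noteq> f v" | "x \<in> U'" "root_of ?g ?R x \<notin> B"
          using x by auto
        then show ?thesis
        proof cases
          case 1
          then show ?thesis using pN by simp
        next
          case 2
          have "w \<in> U'" using w nB by auto
          then show ?thesis using 2 nB by (simp add: w_def)
        next
          case 3
          then show ?thesis using Nv by simp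
        next
          case 4
          have e: "?g x = f x" using 4 by (simp add: prune_def)
          have "root_of ?g ?R (f x) \<notin> B"
            using 4(2) root_of_parent[OF g dj 4(1)] by (simp add: e)
          moreover have "f x \<in> U' \<union> ?R" using rooted_forestsD(1)[OF g 4(1)] by (simp add: e)
          ultimately show ?thesis by auto
        qed
      qed
      then have "f ` ?X \<subseteq> ?X" by blast
      moreover have "?X \<subseteq> U" using v N by (auto simp: U')
      ultimately have "?X = {}" by (intro rooted_forestsD(3)[OF f])
      then show False by simp
    qed
    then show "(prune f U', f v, f (f v)) \<in> ?G" using g pN w by (auto simp: w_def)
    show "(\<lambda>(g, q). \<Psi> g) (prune f U', f v, f (f v)) = \<Psi> (prune f U')" by simp
  next
    fix z assume "z \<in> ?G"
    then obtain g p w where z: "z = (g, p, w)" and g: "g \<in> rooted_forests U' ?R"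
      and p: "p \<in> N" and w0: "w \<in> U' \<union> ?R" and rw: "root_of g ?R w \<in> B" by auto
    have w: "w \<in> U' \<union> B" using w0 rw NB by auto
    let ?f = "\<lambda>x. if x = v then p else if x = p then w else if x \<in> N then v else g x"
    have gU: "g x \<in> U \<union> B" "g x \<noteq> v" if "x \<in> U'" for x
      using rooted_forestsD(1)[OF g that] N vR by (auto simp: U')
    have pv: "p \<noteq> v" "p \<in> U" "p \<notin> U'" using p N by (auto simp: U')
    have wv: "w \<noteq> v" "w \<in> U \<union> B" using w vR by (auto simp: U')
    have "?f \<in> rooted_forests U B"
    proof (rule rooted_forestsI)
      fix X assume X: "X \<subseteq> U" "?f ` X \<subseteq> X"
      then have X2: "?f x \<in> X" if "x \<in> X" for x using that by blast
      \<comment> \<open>from a vertex with root in \<open>B\<close> the parent map leaves \<open>U\<close>; this keeps \<open>w\<close>, hence \<open>p\<close> and \<open>v\<close>, out of \<open>X\<close>\<close>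
      have "root_of g ?R x \<in> B \<longrightarrow> x \<notin> X" if "x \<in> U' \<union> ?R" for x
        using g that
      proof (induction x rule: forest_induct)
        case (root x)
        then show ?case using disj X(1) by auto
      next
        case (child x)
        have "?f x = g x" using child.hyps(1) pv vR by (auto simp: U')
        then show ?case using child X2[of x] root_of_parent[OF g dj child.hyps(1)] by auto
      qed
      then have "w \<notin> X" using w0 rw by blast
      then have "p \<notin> X" using X2[of p] pv by auto
      then have "v \<notin> X" using X2[of v] by auto
      with \<open>p \<notin> X\<close> have "x \<notin> N" if "x \<in> X" for x using X2[OF that] N that by (auto split: if_splits)
      with \<open>v \<notin> X\<close> have XU: "X \<subseteq> U'" using X(1) by (auto simp: U')
      have "g ` X \<subseteq> X"
      proof (intro image_subsetI)
        fix x assume "x \<in> X"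
        then show "g x \<in> X" using X2[of x] subsetD[OF XU, of x] pv by (auto simp: U' split: if_splits)
      qed
      then show "X = {}" using rooted_forestsD(3)[OF g XU] by blast
    next
      fix x assume "x \<in> U"
      then show "?f x \<in> U \<union> B" using gU(1)[of x] pv wv v by (auto simp: U')
    next
      fix x assume "x \<notin> U"
      then show "?f x = x" using rooted_forestsD(2)[OF g, of x] N v pv by (auto simp: U')
    qed
    moreover have "{x \<in> U - {v}. ?f x = v \<or> ?f v = x} = N"
      using gU(2) N pv wv p by (auto simp: U')
    ultimately show "?graft z \<in> ?F" using v pv by (simp add: z forest_nbrs_altdef)
    have "prune ?f U' = g"
      using rooted_forestsD(2)[OF g] pv by (auto simp: prune_def fun_eq_iff U')
    then show "(prune (?graft z) U', (?graft z) v, (?graft z) ((?graft z) v)) = z"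
      using pv by (simp add: z)
  qed
  also have "\<dots> = (\<Sum>g\<in>rooted_forests U' ?R. \<Sum>q\<in>N \<times> ?W g. \<Psi> g)"
  proof (rule sum.Sigma[symmetric])
    have "finite N" using N fin finite_subset by blast
    moreover have "finite U'" using fin by (simp add: U')
    ultimately show "finite (rooted_forests U' ?R)" "\<forall>g\<in>rooted_forests U' ?R. finite (N \<times> ?W g)"
      using fin by (auto intro: finite_rooted_forests)
  qed
  also have "\<dots> = real (card N) * (\<Sum>g\<in>rooted_forests U' ?R. \<Psi> g * real (card (?W g)))"
    by (simp add: sum_distrib_left card_cartesian_product mult_ac)
  finally show ?thesis .
qed

text \<open>The two cases together, with the average over the choices of \<open>w\<close> evaluated by \<open>sum_card_root_in\<close>.
The weight \<open>\<Psi>\<close> may depend on the forest only through the graph induced on \<open>U'\<close>; for a single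
forest on \<open>U'\<close> the number of preimages is not constant.\<close>

lemma sum_forests_nbrs:
  assumes \<Psi>: "\<And>g g'. forest_edges g U' \<inter> U' \<times> U' = forest_edges g' U' \<inter> U' \<times> U' \<Longrightarrow> \<Psi> g = \<Psi> g'"
  shows "real (card B + card N) *
      (\<Sum>f\<in>{f \<in> rooted_forests U B. forest_nbrs f U v = N}. \<Psi> (prune f U')) =
    real (card B * (card B + card N * (card U + card B))) *
      (\<Sum>g\<in>rooted_forests U' (B \<union> N). \<Psi> g)"
proof -
  let ?R = "B \<union> N"
  let ?F = "\<lambda>P. {f \<in> rooted_forests U B. forest_nbrs f U v = N \<and> P (f v)}"
  have fN: "finite N" using N fin finite_subset by blast
  have fU': "finite U'" using fin by (simp add: U')
  have dj: "U' \<inter> ?R = {}" using disj by (auto simp: U')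
  have cR: "card ?R = card B + card N"
    using N disj fin fN by (intro card_Un_disjoint) auto
  have "insert v (U' \<union> ?R) = U \<union> B" "v \<notin> U' \<union> ?R"
    using N disj v by (auto simp: U')
  then have "Suc (card (U' \<union> ?R)) = card (U \<union> B)"
    using fU' fN fin by (metis card_insert_disjoint finite_UnI)
  then have cU: "Suc (card (U' \<union> ?R)) = card U + card B"
    using fin disj by (simp add: card_Un_disjoint)
  let ?S = "\<Sum>g\<in>rooted_forests U' ?R. \<Psi> g"
  let ?T = "\<Sum>g\<in>rooted_forests U' ?R. \<Psi> g * real (card {w \<in> U' \<union> ?R. root_of g ?R w \<in> B})"
  have "(\<Sum>f\<in>{f \<in> rooted_forests U B. forest_nbrs f U v = N}. \<Psi> (prune f U')) =
      (\<Sum>f\<in>?F (\<lambda>y. y \<in> B) \<union> ?F (\<lambda>y. y \<in> U). \<Psi> (prune f U'))"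
    using rooted_forestsD(1)[OF _ v] by (intro sum.cong refl) blast
  also have "\<dots> = real (card B) * ?S + real (card N) * ?T"
    using finite_rooted_forests[OF fin] disj
    by (subst sum.union_disjoint)
      (auto simp: sum_forests_parent_root sum_forests_parent_nonroot)
  finally have "real (card ?R) * (\<Sum>f\<in>{f \<in> rooted_forests U B. forest_nbrs f U v = N}. \<Psi> (prune f U')) =
      real (card ?R) * real (card B) * ?S + real (card N) * (real (card ?R) * ?T)"
    by (simp add: algebra_simps)
  also have "real (card ?R) * ?T = real (card B) * (real (card (U' \<union> ?R)) * ?S)"
    using fin fN by (intro sum_card_root_in[OF fU' _ dj _ \<Psi>]) auto
  also have "real (card (U' \<union> ?R)) = real (card U + card B) - 1"
    using cU by linarith
  also have "real (card ?R) * real (card B) * ?S +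
      real (card N) * (real (card B) * ((real (card U + card B) - 1) * ?S)) =
      real (card B * (card B + card N * (card U + card B))) * ?S"
    by (simp add: cR algebra_simps)
  finally show ?thesis by (simp only: cR)
qed

end

section \<open>Greedy size and odd heights have the same law\<close>

text \<open>The recursion of \<open>forest_number\<close> along greedy steps, where \<open>i\<close> is the number of vertices blocked by the
first active vertex and \<open>p\<close> counts the other non-roots. The factor \<open>b + i\<close> in \<open>forest_number\<close>
cancels the denominator, and what remains is a combination of the total mass and the first moment
of the binomial expansion of \<open>(1 + k)\<^bsup>p - k\<^esup>\<close>.\<close>

lemma forest_number_greedy_rec:
  assumes b: "b > 0"
  shows "(\<Sum>i\<le>p. real (p choose i) *
        (real (b * (b + i * (Suc p + b))) / real (b + i) * real (forest_number (p - i) (b + i) k))) =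
      real (forest_number (Suc p) b (Suc k))"
proof -
  let ?c = "\<lambda>i. real (b * (b + i * (Suc p + b))) / real (b + i)"
  let ?t = "\<lambda>i. real (p choose i) * (?c i * real (forest_number (p - i) (b + i) k))"
  consider "k = 0" | "k > p" | "0 < k" "k \<le> p" by linarith
  then show ?thesis
  proof cases
    case 1
    have "(\<Sum>i\<le>p. ?t i) = (\<Sum>i\<le>p. if i = p then ?c p else 0)"
      using 1 by (intro sum.cong) (auto simp: forest_number_def)
    also have "\<dots> = ?c p" by simp
    also have "b * (b + p * (Suc p + b)) = b * Suc p * (b + p)" by (simp add: algebra_simps)
    also have "real (b * Suc p * (b + p)) / real (b + p) = real (b * Suc p)"
      using b by (subst of_nat_mult) (rule nonzero_mult_div_cancel_right, simp)
    also have "b * Suc p = forest_number (Suc p) b (Suc k)"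
      using 1 by (simp add: forest_number_def)
    finally show ?thesis .
  next
    case 2
    then have "p - i < k" "k \<noteq> 0" for i by linarith+
    then have "?t i = 0" for i by (simp add: forest_number_def)
    then have "(\<Sum>i\<le>p. ?t i) = 0" by (intro sum.neutral ballI)
    moreover have "forest_number (Suc p) b (Suc k) = 0" using 2 by (simp add: forest_number_def)
    ultimately show ?thesis by (simp only: of_nat_0)
  next
    case 3
    define q where "q = p - k"
    have p: "p = k + q" using 3 by (simp add: q_def)
    \<comment> \<open>the part of each summand that does not depend on \<open>i\<close>\<close>
    define D where "D = (p choose k) * b * (b + q) ^ (k - 1)"
    have t: "?t i = real (D * (b * ((q choose i) * 1 ^ i * k ^ (q - i)) +
        (Suc p + b) * (i * ((q choose i) * 1 ^ i * k ^ (q - i)))))" if "i \<le> p" for i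
    proof (cases "i \<le> q")
      case True
      have "(p choose q) * (q choose i) = (p choose i) * ((p - i) choose (q - i))"
        using True p by (intro choose_mult) auto
      moreover have "(p - i) choose (q - i) = (p - i) choose k"
        using True p by (subst binomial_symmetric) auto
      moreover have "p choose q = p choose k" using p by (subst binomial_symmetric) auto
      ultimately have c: "(p choose i) * ((p - i) choose k) = (p choose k) * (q choose i)" by simp
      have e: "p - i + (b + i) - k = b + q" "p - (i + k) = q - i" using True p by auto
      have "(p choose i) * forest_number (p - i) (b + i) k =
          ((p choose i) * ((p - i) choose k)) * (b + i) * (b + q) ^ (k - 1) * k ^ (q - i)"
        using 3 by (simp add: forest_number_def e)
      then have f: "real (p choose i) * real (forest_number (p - i) (b + i) k) =
          real (b + i) * real ((p choose k) * (q choose i) * (b + q) ^ (k - 1) * k ^ (q - i))"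
        unfolding c of_nat_mult[symmetric] of_nat_eq_iff by (simp only: mult_ac)
      have "?t i = ?c i * (real (p choose i) * real (forest_number (p - i) (b + i) k))"
        by (simp only: mult_ac)
      also have "\<dots> = real (b * (b + i * (Suc p + b))) *
          real ((p choose k) * (q choose i) * (b + q) ^ (k - 1) * k ^ (q - i))"
        unfolding f using b by simp
      also have "\<dots> = real (D * (b * ((q choose i) * 1 ^ i * k ^ (q - i)) +
          (Suc p + b) * (i * ((q choose i) * 1 ^ i * k ^ (q - i)))))"
        unfolding of_nat_mult[symmetric] of_nat_eq_iff D_def power_one mult_1_right
        by (simp only: distrib_left distrib_right mult_ac)
      finally show ?thesis .
    next
      case False
      then have z: "(p - i) choose k = 0" "q choose i = 0" using p 3 by (simp_all add: binomial_eq_0)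
      have "forest_number (p - i) (b + i) k = 0" using 3(1) by (simp add: forest_number_def z)
      then show ?thesis by (simp add: z)
    qed
    have "(\<Sum>i\<le>p. ?t i) = real (\<Sum>i\<le>p. D * (b * ((q choose i) * 1 ^ i * k ^ (q - i)) +
        (Suc p + b) * (i * ((q choose i) * 1 ^ i * k ^ (q - i)))))"
      unfolding of_nat_sum by (intro sum.cong refl t) simp
    also have "(\<Sum>i\<le>p. D * (b * ((q choose i) * 1 ^ i * k ^ (q - i)) +
        (Suc p + b) * (i * ((q choose i) * 1 ^ i * k ^ (q - i))))) =
      (\<Sum>i\<le>q. D * (b * ((q choose i) * 1 ^ i * k ^ (q - i)) +
        (Suc p + b) * (i * ((q choose i) * 1 ^ i * k ^ (q - i)))))"
      using p by (intro sum.mono_neutral_right) auto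
    also have "\<dots> = D * (b * (\<Sum>i\<le>q. (q choose i) * 1 ^ i * k ^ (q - i)) +
        (Suc p + b) * (\<Sum>i\<le>q. i * ((q choose i) * 1 ^ i * k ^ (q - i))))"
      by (simp only: sum_distrib_left[symmetric] sum.distrib)
    also have "(\<Sum>i\<le>q. (q choose i) * 1 ^ i * k ^ (q - i)) = Suc k ^ q"
      using binomial[of 1 k q] by simp
    also have "(\<Sum>i\<le>q. i * ((q choose i) * 1 ^ i * k ^ (q - i))) = q * Suc k ^ (q - 1)"
      using binomial_first_moment[of q 1 k] by simp
    also have "D * (b * Suc k ^ q + (Suc p + b) * (q * Suc k ^ (q - 1))) =
        forest_number (Suc p) b (Suc k)"
    proof -
      have F: "forest_number (Suc p) b (Suc k) =
          (Suc p choose Suc k) * b * (b + q) ^ k * Suc k ^ q"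
        using p by (simp add: forest_number_def add.commute del: binomial_Suc_Suc)
      have G: "s * b * A + C * (q * A) = A * (s * b + C * q)" for s A C :: nat
        by (simp add: algebra_simps)
      have "Suc k * (q * Suc k ^ (q - 1)) = q * Suc k ^ q" by (cases q) (simp_all add: algebra_simps)
      moreover have "Suc k * (b * A + C * X) = Suc k * b * A + C * (Suc k * X)" for A C X
        by (simp add: algebra_simps)
      ultimately have "Suc k * (b * Suc k ^ q + (Suc p + b) * (q * Suc k ^ (q - 1))) =
          Suc k * b * Suc k ^ q + (Suc p + b) * (q * Suc k ^ q)"
        by (simp only:)
      also have "\<dots> = Suc k ^ q * (Suc k * b + (Suc p + b) * q)"
        by (rule G)
      also have "Suc k * b + (Suc p + b) * q = Suc p * (b + q)"
        using p by (simp add: algebra_simps)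
      finally have "Suc k * (D * (b * Suc k ^ q + (Suc p + b) * (q * Suc k ^ (q - 1)))) =
          D * (Suc k ^ q * (Suc p * (b + q)))"
        by (metis mult.left_commute)
      also have "\<dots> = (Suc p * (p choose k)) * b * ((b + q) * (b + q) ^ (k - 1)) * Suc k ^ q"
        unfolding D_def by (simp only: mult_ac)
      also have "(b + q) * (b + q) ^ (k - 1) = (b + q) ^ k" using 3 by (cases k) auto
      also have "Suc p * (p choose k) = Suc k * (Suc p choose Suc k)"
        by (rule Suc_times_binomial[symmetric])
      also have "Suc k * (Suc p choose Suc k) * b * (b + q) ^ k * Suc k ^ q =
          Suc k * forest_number (Suc p) b (Suc k)"
        unfolding F by (simp only: mult.assoc)
      finally show ?thesis by (simp only: mult_cancel1) simp
    qed
    finally show ?thesis .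
  qed
qed

lemma forest_edges_prune:
  assumes "S \<subseteq> U"
  shows "forest_edges f U \<inter> S \<times> S = forest_edges (prune f S) S \<inter> S \<times> S"
  using assms by (auto simp: forest_edges_within prune_def)

text \<open>The central identity: for a uniform forest with root set \<open>B\<close>, the size of the greedy independent set on
\<open>U\<close> has the law of the number of vertices at odd height, by comparison with
\<open>card_rooted_forests_odd_height\<close>. Each choice of the first active vertex contributes equally, so
that the factor \<open>1 / card U\<close> cancels.\<close>

lemma sum_greedy_size_prob_forests:
  assumes "finite U" "finite B" "U \<inter> B = {}"
  shows "(\<Sum>f\<in>rooted_forests U B. greedy_size_prob (forest_edges f U) k U) =
    real (forest_number (card U) (card B) k)"
  using assms
proof (induction k arbitrary: U B)
  case 0
  then show ?case by (cases "U = {}") (auto simp: forest_number_def)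
next
  case (Suc k)
  show ?case
  proof (cases "U = {} \<or> B = {}")
    case True
    then show ?thesis
      using Suc.prems(1) by (cases "U = {}") (auto simp: forest_number_def rooted_forests_no_roots)
  next
    case False
    define b where "b = card B"
    define p where "p = card U - 1"
    have b: "b > 0" using False Suc.prems by (auto simp: b_def card_gt_0_iff)
    have u: "card U = Suc p" using False Suc.prems by (auto simp: p_def card_gt_0_iff)
    have finF: "finite (rooted_forests U B)" using Suc.prems by (intro finite_rooted_forests)
    let ?gp = "\<lambda>f S. greedy_size_prob (forest_edges f U) k S"
    let ?c = "\<lambda>i. real (b * (b + i * (Suc p + b))) / real (b + i)"
    have step: "(\<Sum>f\<in>{f \<in> rooted_forests U B. forest_nbrs f U v = N}. ?gp f (U - {v} - N)) =
        ?c (card N) * real (forest_number (p - card N) (b + card N) k)"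
      if v: "v \<in> U" and N: "N \<subseteq> U - {v}" for v N
    proof -
      let ?S = "U - {v} - N"
      have fN: "finite N" using N Suc.prems(1) finite_subset by blast
      have cN: "card ?S = p - card N" using N v u fN by (simp add: card_Diff_subset)
      have cB: "card (B \<union> N) = b + card N"
        using N fN Suc.prems unfolding b_def by (intro card_Un_disjoint) auto
      have "(\<Sum>f\<in>{f \<in> rooted_forests U B. forest_nbrs f U v = N}. ?gp f ?S) =
          (\<Sum>f\<in>{f \<in> rooted_forests U B. forest_nbrs f U v = N}.
             greedy_size_prob (forest_edges (prune f ?S) ?S) k ?S)"
        by (intro sum.cong refl greedy_size_prob_cong forest_edges_prune) auto
      moreover have "real (b + card N) * (\<Sum>f\<in>{f \<in> rooted_forests U B. forest_nbrs f U v = N}.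
             greedy_size_prob (forest_edges (prune f ?S) ?S) k ?S) =
          real (b * (b + card N * (Suc p + b))) *
            (\<Sum>g\<in>rooted_forests ?S (B \<union> N). greedy_size_prob (forest_edges g ?S) k ?S)"
        unfolding b_def u[symmetric]
        by (rule sum_forests_nbrs[OF Suc.prems v N refl]) (rule greedy_size_prob_cong)
      moreover have "(\<Sum>g\<in>rooted_forests ?S (B \<union> N). greedy_size_prob (forest_edges g ?S) k ?S) =
          real (forest_number (p - card N) (b + card N) k)"
        using Suc.IH[of ?S "B \<union> N"] Suc.prems fN by (auto simp: cN cB)
      ultimately show ?thesis using b by (simp add: field_simps)
    qed
    have total: "(\<Sum>f\<in>rooted_forests U B. ?gp f (U - {v} - forest_nbrs f U v)) =
        real (forest_number (Suc p) b (Suc k))" if v: "v \<in> U" for v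
    proof -
      have "(\<Sum>f\<in>rooted_forests U B. ?gp f (U - {v} - forest_nbrs f U v)) =
          (\<Sum>N\<in>Pow (U - {v}). \<Sum>f\<in>{f \<in> rooted_forests U B. forest_nbrs f U v = N}.
             ?gp f (U - {v} - forest_nbrs f U v))"
        using finF Suc.prems by (intro sum.group[symmetric]) (auto simp: forest_nbrs_def)
      also have "\<dots> = (\<Sum>N\<in>Pow (U - {v}). ?c (card N) * real (forest_number (p - card N) (b + card N) k))"
      proof (rule sum.cong[OF refl])
        fix N assume "N \<in> Pow (U - {v})"
        then show "(\<Sum>f\<in>{f \<in> rooted_forests U B. forest_nbrs f U v = N}.
             ?gp f (U - {v} - forest_nbrs f U v)) =
             ?c (card N) * real (forest_number (p - card N) (b + card N) k)"
          using step[OF v, of N] by simp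
      qed
      also have "\<dots> = (\<Sum>i\<le>p. real (p choose i) * (?c i * real (forest_number (p - i) (b + i) k)))"
        using sum_Pow_by_card[of "U - {v}" "\<lambda>i. ?c i * real (forest_number (p - i) (b + i) k)"]
          v u Suc.prems(1) by simp
      also have "\<dots> = real (forest_number (Suc p) b (Suc k))"
        by (rule forest_number_greedy_rec[OF b])
      finally show ?thesis .
    qed
    have "(\<Sum>f\<in>rooted_forests U B. greedy_size_prob (forest_edges f U) (Suc k) U) =
        (\<Sum>f\<in>rooted_forests U B. \<Sum>v\<in>U. ?gp f (U - {v} - forest_nbrs f U v)) / real (card U)"
      by (simp add: sum_divide_distrib forest_nbrs_def)
    also have "(\<Sum>f\<in>rooted_forests U B. \<Sum>v\<in>U. ?gp f (U - {v} - forest_nbrs f U v)) =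
        (\<Sum>v\<in>U. \<Sum>f\<in>rooted_forests U B. ?gp f (U - {v} - forest_nbrs f U v))"
      by (rule sum.swap)
    also have "\<dots> = real (card U) * real (forest_number (Suc p) b (Suc k))"
      using total by simp
    finally show ?thesis by (simp add: u b_def)
  qed
qed

section \<open>Trees rooted at a vertex\<close>

lemma rtrancl_imp_simple_path:
  assumes "(x, y) \<in> R\<^sup>*"
  shows "\<exists>c. c \<noteq> [] \<and> hd c = x \<and> last c = y \<and> distinct c \<and> successively (\<lambda>a b. (a, b) \<in> R) c"
  using assms
proof (induction rule: rtrancl_induct)
  case base
  show ?case by (intro exI[of _ "[x]"]) simp
next
  case (step y z)
  then obtain c where c: "c \<noteq> []" "hd c = x" "last c = y" "distinct c"
    "successively (\<lambda>a b. (a, b) \<in> R) c" by blast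
  show ?case
  proof (cases "z \<in> set c")
    case True
    then obtain c1 c2 where s: "c = c1 @ z # c2" by (auto dest: split_list)
    then have "successively (\<lambda>a b. (a, b) \<in> R) (c1 @ [z])"
      using c(5) by (auto simp: successively_append_iff)
    moreover have "hd (c1 @ [z]) = x" using c(2) s by (cases c1) auto
    ultimately show ?thesis using c(4) s by (intro exI[of _ "c1 @ [z]"]) auto
  next
    case False
    then show ?thesis
      using c step.hyps(2) by (intro exI[of _ "c @ [z]"]) (auto simp: successively_append_iff)
  qed
qed

lemma sym_forest_edges: "sym (forest_edges f U)"
  by (auto simp: forest_edges_def sym_def)

lemma forest_edge_cases:
  assumes "(x, y) \<in> forest_edges f U"
  obtains "x \<in> U" "f x = y" | "y \<in> U" "f y = x"
  using assms by (auto simp: forest_edges_def)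

context
  fixes f :: "'a \<Rightarrow> 'a" and V :: "'a set" and v :: 'a
  assumes f: "f \<in> rooted_forests (V - {v}) {v}" and fin: "finite V" and v: "v \<in> V"
begin

lemma forest_edge_height:
  assumes "(x, y) \<in> forest_edges f (V - {v})"
  shows "height f {v} x = Suc (height f {v} y) \<and> f x = y \<or>
         height f {v} y = Suc (height f {v} x) \<and> f y = x"
  using assms height_parent[OF f] by (elim forest_edge_cases) auto

text \<open>A highest vertex of a cycle would have two distinct neighbours that are not higher, but the only such
neighbour of a vertex is its parent.\<close>

lemma forest_edges_no_cycle: "\<not> is_cycle (forest_edges f (V - {v})) c"
proof
  assume "is_cycle (forest_edges f (V - {v})) c"
  then have len: "length c \<ge> 3" and dist: "distinct c"
    and e: "\<And>i. i < length c \<Longrightarrow> (c ! i, c ! (Suc i mod length c)) \<in> forest_edges f (V - {v})"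
    by (auto simp: is_cycle_def)
  let ?L = "length c" and ?h = "\<lambda>i. height f {v} (c ! i)"
  have "Max (?h ` {..<?L}) \<in> ?h ` {..<?L}" using len by (intro Max_in) (auto simp: lessThan_empty_iff)
  then obtain j where j: "j < ?L" "?h j = Max (?h ` {..<?L})" by auto
  have top: "?h i \<le> ?h j" if "i < ?L" for i
    unfolding j(2) using that by (intro Max_ge) auto
  \<comment> \<open>the cyclic predecessor and successor of \<open>j\<close>\<close>
  define i where "i = (if j = 0 then ?L - 1 else j - 1)"
  define k where "k = (if Suc j = ?L then 0 else Suc j)"
  have ik: "i < ?L" "k < ?L" "i \<noteq> k" using j(1) len by (auto simp: i_def k_def)
  have "Suc i mod ?L = j" "Suc j mod ?L = k" using j(1) len by (auto simp: i_def k_def)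
  then have "(c ! i, c ! j) \<in> forest_edges f (V - {v})" "(c ! j, c ! k) \<in> forest_edges f (V - {v})"
    using e[OF ik(1)] e[OF j(1)] by simp_all
  then have "f (c ! j) = c ! i" "f (c ! j) = c ! k"
    using forest_edge_height[of "c ! i" "c ! j"] forest_edge_height[of "c ! j" "c ! k"]
      top[OF ik(1)] top[OF ik(2)] by auto
  then show False using nth_eq_iff_index_eq[OF dist ik(1,2)] ik(3) by simp
qed

lemma is_tree_forest_edges: "is_tree V (forest_edges f (V - {v}))"
proof -
  let ?E = "forest_edges f (V - {v})"
  have "simple_graph V ?E"
    unfolding simple_graph_def
  proof (intro conjI fin sym_forest_edges)
    show "?E \<subseteq> V \<times> V" using rooted_forestsD(1)[OF f] v by (auto simp: forest_edges_def)
    show "irrefl ?E" using forest_edge_height[of x x for x] by (auto simp: irrefl_def)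
  qed
  moreover have r: "(x, v) \<in> ?E\<^sup>*" if "x \<in> (V - {v}) \<union> {v}" for x
    using f that
  proof (induction x rule: forest_induct)
    case (child x)
    then have "(x, f x) \<in> ?E" by (auto simp: forest_edges_def)
    then show ?case using child.IH by (rule converse_rtrancl_into_rtrancl)
  qed simp
  have "connected_graph V ?E"
    unfolding connected_graph_def
  proof (intro conjI ballI)
    fix x y assume "x \<in> V" "y \<in> V"
    then have xv: "(x, v) \<in> ?E\<^sup>*" and yv: "(y, v) \<in> ?E\<^sup>*" using r by auto
    have "(v, y) \<in> ?E\<^sup>*"
      using yv by (rule symD[OF sym_rtrancl[OF sym_forest_edges]])
    with xv show "(x, y) \<in> ?E\<^sup>*" by (rule rtrancl_trans)
  qed (use v in auto)
  ultimately show ?thesis using forest_edges_no_cycle by (auto simp: is_tree_def)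
qed

text \<open>The height changes by one along every edge, so every walk from \<open>v\<close> to \<open>x\<close> has the parity of the
height of \<open>x\<close>; a shortest walk is one of them.\<close>

lemma even_graph_dist_iff_even_height:
  assumes x: "x \<in> V"
  shows "even (graph_dist (forest_edges f (V - {v})) v x) \<longleftrightarrow> even (height f {v} x)"
proof -
  let ?E = "forest_edges f (V - {v})"
  have walk: "even k \<longleftrightarrow> even (height f {v} y)" if "(v, y) \<in> ?E ^^ k" for y k
    using that
  proof (induction k arbitrary: y)
    case (Suc k)
    then obtain z where "(v, z) \<in> ?E ^^ k" "(z, y) \<in> ?E" by auto
    then show ?case using Suc.IH[of z] forest_edge_height[of z y] by auto
  qed simp
  have "(v, x) \<in> ?E\<^sup>*"
    using is_tree_forest_edges v x by (auto simp: is_tree_def connected_graph_def)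
  then obtain k where "(v, x) \<in> ?E ^^ k" using rtrancl_imp_relpow by blast
  then have "(v, x) \<in> ?E ^^ graph_dist ?E v x"
    unfolding graph_dist_def by (rule LeastI)
  then show ?thesis by (rule walk)
qed

lemma card_even_graph_dist:
  "card {x \<in> V. even (graph_dist (forest_edges f (V - {v})) v x)} + odd_height_count f (V - {v}) {v} = card V"
proof -
  have "{x \<in> V. even (graph_dist (forest_edges f (V - {v})) v x)} = V - {x \<in> V - {v}. odd (height f {v} x)}"
    using even_graph_dist_iff_even_height by fastforce
  moreover have "card (V - {x \<in> V - {v}. odd (height f {v} x)}) + card {x \<in> V - {v}. odd (height f {v} x)} = card V"
    using fin by (subst card_Diff_subset) (auto intro!: le_add_diff_inverse2 card_mono)
  ultimately show ?thesis by (simp add: odd_height_count_def)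
qed

end

text \<open>Knowing the roots determines the orientation of every edge: going up from the roots, a vertex \<open>x\<close>
cannot be the parent of \<open>f x\<close>, since \<open>f x\<close> already has another parent.\<close>

lemma inj_on_forest_edges:
  assumes "U \<inter> B = {}"
  shows "inj_on (\<lambda>f. forest_edges f U) (rooted_forests U B)"
proof (rule inj_onI)
  fix f g assume f: "f \<in> rooted_forests U B" and g: "g \<in> rooted_forests U B"
    and eq: "forest_edges f U = forest_edges g U"
  have "x \<in> U \<longrightarrow> f x = g x" if "x \<in> U \<union> B" for x
    using f that
  proof (induction x rule: forest_induct)
    case (root x)
    then show ?case using assms by auto
  next
    case (child x)
    then have "(x, f x) \<in> forest_edges g U" unfolding eq[symmetric] by (auto simp: forest_edges_def)
    then show ?case
    proof (cases rule: forest_edge_cases)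
      case 2
      then have "f (f x) = x" using child.IH by simp
      then show ?thesis using grandparent_neq[OF f child.hyps(1) 2(1)] by simp
    qed simp
  qed
  moreover have "f x = g x" if "x \<notin> U" for x
    using rooted_forestsD(2)[OF f that] rooted_forestsD(2)[OF g that] by simp
  ultimately show "f = g" by (intro ext) blast
qed

text \<open>The parent of \<open>x\<close> is a neighbour closer to \<open>v\<close>. The edges obtained connect all vertices, so any other
edge of the tree would close a cycle with a simple path between its ends.\<close>

lemma tree_imp_forest_edges:
  assumes tree: "is_tree V E" and v: "v \<in> V"
  shows "\<exists>f\<in>rooted_forests (V - {v}) {v}. forest_edges f (V - {v}) = E"
proof -
  have fin: "finite V" and EV: "E \<subseteq> V \<times> V" and sym: "sym E" and irr: "irrefl E"
    and nocyc: "\<And>c. \<not> is_cycle E c"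
    and conn: "\<And>x y. x \<in> V \<Longrightarrow> y \<in> V \<Longrightarrow> (x, y) \<in> E\<^sup>*"
    using tree by (auto simp: is_tree_def simple_graph_def connected_graph_def)
  let ?d = "graph_dist E v"
  have "\<exists>y. (y, x) \<in> E \<and> ?d y < ?d x" if x: "x \<in> V - {v}" for x
  proof -
    obtain k where "(v, x) \<in> E ^^ k" using conn[OF v] x rtrancl_imp_relpow by blast
    then have d: "(v, x) \<in> E ^^ ?d x" unfolding graph_dist_def by (rule LeastI)
    with x obtain j where j: "?d x = Suc j" by (cases "?d x") auto
    with d obtain y where y: "(v, y) \<in> E ^^ j" "(y, x) \<in> E" by auto
    from y(1) have "?d y \<le> j" unfolding graph_dist_def by (rule Least_le)
    with y(2) j show ?thesis by auto
  qed
  then obtain p where p: "\<And>x. x \<in> V - {v} \<Longrightarrow> (p x, x) \<in> E \<and> ?d (p x) < ?d x" by metis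
  define f where "f x = (if x \<in> V - {v} then p x else x)" for x
  have fp: "(f x, x) \<in> E" "?d (f x) < ?d x" if "x \<in> V - {v}" for x
    using p[OF that] that by (auto simp: f_def)
  have f: "f \<in> rooted_forests (V - {v}) {v}"
  proof (rule rooted_forestsI)
    fix X assume X: "X \<subseteq> V - {v}" "f ` X \<subseteq> X"
    show "X = {}"
    proof (rule ccontr)
      assume "X \<noteq> {}"
      then obtain x where "x \<in> X" "\<And>y. y \<in> X \<Longrightarrow> ?d x \<le> ?d y"
        using ex_has_least_nat[of "\<lambda>x. x \<in> X" _ ?d] by blast
      then have "f x \<in> X" "?d x \<le> ?d (f x)" "x \<in> V - {v}" using X by (auto simp: image_subset_iff)
      then show False using fp(2)[of x] by simp
    qed
  next
    fix x assume "x \<in> V - {v}"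
    then show "f x \<in> V - {v} \<union> {v}" using fp(1)[of x] EV by auto
  next
    fix x assume "x \<notin> V - {v}"
    then show "f x = x" by (simp only: f_def if_False)
  qed
  let ?F = "forest_edges f (V - {v})"
  have FE: "?F \<subseteq> E" using fp(1) sym by (auto simp: forest_edges_def dest: symD)
  moreover have "(x, y) \<in> ?F" if xy: "(x, y) \<in> E" for x y
  proof (rule ccontr)
    assume nF: "(x, y) \<notin> ?F"
    have V: "x \<in> V" "y \<in> V" using xy EV by auto
    then have "(y, x) \<in> ?F\<^sup>*"
      using is_tree_forest_edges[OF f fin v] by (auto simp: is_tree_def connected_graph_def)
    then obtain c where c: "c \<noteq> []" "hd c = y" "last c = x" "distinct c"
      "successively (\<lambda>a b. (a, b) \<in> ?F) c" using rtrancl_imp_simple_path by metis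
    have "x \<noteq> y" using xy irr by (auto simp: irrefl_def)
    moreover have "(y, x) \<notin> ?F" using nF symD[OF sym_forest_edges, of y x f "V - {v}"] by blast
    ultimately have "length c \<ge> 3"
      using c by (cases c; cases "tl c"; cases "tl (tl c)") auto
    moreover have "(c ! i, c ! (Suc i mod length c)) \<in> E" if i: "i < length c" for i
    proof (cases "Suc i = length c")
      case True
      then have "c ! i = x" using c(1,3) by (metis diff_Suc_1 last_conv_nth)
      then show ?thesis using True xy c(1,2) by (simp add: hd_conv_nth)
    next
      case False
      then have "(c ! i, c ! Suc i) \<in> ?F"
        using c(5) i by (simp add: successively_conv_nth)
      then show ?thesis using False i FE by auto
    qed
    ultimately have "is_cycle E c" using c(4) by (simp add: is_cycle_def)
    then show False using nocyc by blast
  qed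
  ultimately show ?thesis using f by (intro bexI[of _ f]) auto
qed

lemma bij_betw_forests_trees:
  assumes "finite V" "v \<in> V"
  shows "bij_betw (\<lambda>f. forest_edges f (V - {v})) (rooted_forests (V - {v}) {v}) {E. is_tree V E}"
  unfolding bij_betw_def
proof
  show "inj_on (\<lambda>f. forest_edges f (V - {v})) (rooted_forests (V - {v}) {v})"
    by (rule inj_on_forest_edges) auto
  show "(\<lambda>f. forest_edges f (V - {v})) ` rooted_forests (V - {v}) {v} = {E. is_tree V E}"
    using tree_imp_forest_edges[OF _ assms(2)] is_tree_forest_edges[OF _ assms] by auto
qed

section \<open>Cayley trees\<close>

text \<open>The number of trees on \<open>n\<close> vertices with \<open>k\<close> vertices at even distance from a given vertex \<open>v\<close>, including
\<open>v\<close> itself. The remaining \<open>n - k\<close> are the vertices at odd height of a forest with the single root \<open>v\<close>.\<close>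

definition even_height_tree_count :: "nat \<Rightarrow> nat \<Rightarrow> nat" where
  "even_height_tree_count n k = (if k = 0 \<or> k > n then 0 else forest_number (n - 1) 1 (n - k))"

text \<open>Once the first active vertex \<open>v\<close> is fixed, the undetermined vertices carry the forest above the first
layer of the tree rooted at \<open>v\<close>. The greedy procedure on it counts odd heights there, which are
the nonzero even heights in the tree; on the level of numbers this is \<open>forest_number_rec\<close> read from
left to right.\<close>

lemma sum_trees_greedy:
  assumes V: "finite V" "v \<in> V"
  shows "(\<Sum>E | is_tree V E. greedy_size_prob E j (V - {v} - {w \<in> V - {v}. (v, w) \<in> E})) =
    real (even_height_tree_count (card V) (Suc j))"
proof -
  let ?U = "V - {v}"
  define p where "p = card ?U"
  have cV: "card V = Suc p" using V card_Suc_Diff1 by (metis p_def)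
  have fU: "finite ?U" using V by simp
  let ?\<Phi> = "\<lambda>N g. greedy_size_prob (forest_edges g (?U - N)) j (?U - N)"
  have "(\<Sum>E | is_tree V E. greedy_size_prob E j (?U - {w \<in> ?U. (v, w) \<in> E})) =
      (\<Sum>f\<in>rooted_forests ?U {v}. greedy_size_prob (forest_edges f ?U) j
          (?U - {w \<in> ?U. (v, w) \<in> forest_edges f ?U}))"
    by (rule sum.reindex_bij_betw[OF bij_betw_forests_trees[OF V], symmetric])
  also have "\<dots> = (\<Sum>f\<in>rooted_forests ?U {v}. ?\<Phi> (layer f ?U {v}) (prune f (?U - layer f ?U {v})))"
  proof (rule sum.cong[OF refl])
    fix f
    have "{w \<in> ?U. (v, w) \<in> forest_edges f ?U} = layer f ?U {v}"
      by (auto simp: layer_def forest_edges_def)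
    moreover have "greedy_size_prob (forest_edges f ?U) j (?U - layer f ?U {v}) =
        ?\<Phi> (layer f ?U {v}) (prune f (?U - layer f ?U {v}))"
      by (intro greedy_size_prob_cong forest_edges_prune) auto
    ultimately show "greedy_size_prob (forest_edges f ?U) j (?U - {w \<in> ?U. (v, w) \<in> forest_edges f ?U}) =
        ?\<Phi> (layer f ?U {v}) (prune f (?U - layer f ?U {v}))" by simp
  qed
  also have "\<dots> = (\<Sum>N\<in>Pow ?U. \<Sum>g\<in>rooted_forests (?U - N) N. ?\<Phi> N g)"
    using sum_rooted_forests_by_layer[OF fU, of "{v}" ?\<Phi>] by simp
  also have "\<dots> = (\<Sum>N\<in>Pow ?U. real (forest_number (p - card N) (card N) j))"
  proof (rule sum.cong[OF refl])
    fix N assume "N \<in> Pow ?U"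
    then have N: "N \<subseteq> ?U" "finite N" using fU finite_subset by auto
    then have "card (?U - N) = p - card N" by (simp add: card_Diff_subset p_def)
    then show "(\<Sum>g\<in>rooted_forests (?U - N) N. ?\<Phi> N g) = real (forest_number (p - card N) (card N) j)"
      using sum_greedy_size_prob_forests[of "?U - N" N j] fU N by auto
  qed
  also have "\<dots> = real (\<Sum>i\<le>p. (p choose i) * (1 ^ i * forest_number (p - i) i j))"
    using sum_Pow_by_card[OF fU, of "\<lambda>i. real (forest_number (p - i) i j)"] by (simp add: p_def)
  also have "(\<Sum>i\<le>p. (p choose i) * (1 ^ i * forest_number (p - i) i j)) = even_height_tree_count (Suc p) (Suc j)"
  proof -
    consider "j > p" | "p = 0" "j = 0" | "p \<ge> 1" "j \<le> p" by linarith
    then show ?thesis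
    proof cases
      case 1
      then have "forest_number (p - i) i j = 0" for i by (simp add: forest_number_def binomial_eq_0)
      then show ?thesis using 1 by (simp add: even_height_tree_count_def)
    next
      case 2
      then show ?thesis by (simp add: even_height_tree_count_def forest_number_def)
    next
      case 3
      then show ?thesis
        using forest_number_rec[of p "p - j" 1] by (simp add: even_height_tree_count_def)
    qed
  qed
  finally show ?thesis by (simp only: cV)
qed

lemma card_trees_even_dist:
  assumes V: "finite V" "v \<in> V"
  shows "card {E. is_tree V E \<and> card {x \<in> V. even (graph_dist E v x)} = k} = even_height_tree_count (card V) k"
proof -
  let ?U = "V - {v}" and ?e = "\<lambda>E. card {x \<in> V. even (graph_dist E v x)}"
  define p where "p = card ?U"
  have cV: "card V = Suc p" using V card_Suc_Diff1 by (metis p_def)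
  have bij: "bij_betw (\<lambda>f. forest_edges f ?U) {f \<in> rooted_forests ?U {v}. ?e (forest_edges f ?U) = k}
      {E \<in> {E. is_tree V E}. ?e E = k}"
    using bij_betw_forests_trees[OF V] by (rule bij_betw_Collect) simp
  have ev: "?e (forest_edges f ?U) + odd_height_count f ?U {v} = Suc p"
    if "f \<in> rooted_forests ?U {v}" for f
    using card_even_graph_dist[OF that V] by (simp only: cV)
  have odd_le: "odd_height_count f ?U {v} \<le> p" for f
    unfolding odd_height_count_def p_def using V by (intro card_mono) auto
  have "card {E. is_tree V E \<and> ?e E = k} = card {f \<in> rooted_forests ?U {v}. ?e (forest_edges f ?U) = k}"
    using bij_betw_same_card[OF bij] by simp
  also have "\<dots> = even_height_tree_count (Suc p) k"
  proof (cases "k = 0 \<or> k > Suc p")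
    case True
    have "?e (forest_edges f ?U) \<noteq> k" if "f \<in> rooted_forests ?U {v}" for f
      using True ev[OF that] odd_le[of f] by linarith
    then have "{f \<in> rooted_forests ?U {v}. ?e (forest_edges f ?U) = k} = {}" by simp
    moreover have "even_height_tree_count (Suc p) k = 0" using True by (simp add: even_height_tree_count_def)
    ultimately show ?thesis by (simp only: card.empty)
  next
    case False
    then have "{f \<in> rooted_forests ?U {v}. ?e (forest_edges f ?U) = k} =
        {f \<in> rooted_forests ?U {v}. odd_height_count f ?U {v} = Suc p - k}"
      using ev by fastforce
    then show ?thesis
      using card_rooted_forests_odd_height[of ?U "{v}" "Suc p - k"] V False
      by (simp add: even_height_tree_count_def p_def)
  qed
  finally show ?thesis by (simp only: cV)
qed

lemma card_cayley_trees:
  assumes "n \<ge> 2"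
  shows "card (cayley_trees n) = n ^ (n - 2)"
proof -
  have "card (cayley_trees n) = card (rooted_forests ({1..n} - {1}) {1})"
    using bij_betw_same_card[OF bij_betw_forests_trees[of "{1..n}" 1]] assms
    by (simp add: cayley_trees_def)
  also have "\<dots> = card {1::nat} * (card ({1..n} - {1}) + card {1::nat}) ^ (card ({1..n} - {1}) - 1)"
  proof (rule card_rooted_forests)
    have "2 \<in> {1..n} - {1}" using assms by auto
    then show "{1..n} - {1} \<noteq> {}" by blast
  qed auto
  also have "\<dots> = n ^ (n - 2)" using assms by (simp add: numeral_2_eq_2)
  finally show ?thesis .
qed

lemma pmf_G_law:
  assumes "n \<ge> 1"
  shows "pmf (G_law n) k = real (even_height_tree_count n k) / real (card (cayley_trees n))"
proof -
  let ?T = "cayley_trees n" and ?V = "{1..n}"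
  have "pmf (G_law n) k = (\<Sum>E\<in>?T. pmf (map_pmf card (greedy_independent_set ?V E)) k) / real (card ?T)"
    unfolding G_law_def random_cayley_tree_def
    by (rule pmf_bind_pmf_of_set[OF cayley_trees_nonempty[OF assms] finite_cayley_trees])
  also have "(\<Sum>E\<in>?T. pmf (map_pmf card (greedy_independent_set ?V E)) k) =
      (\<Sum>E\<in>?T. greedy_size_prob E k ?V)"
    unfolding greedy_independent_set_def by (subst pmf_card_greedy_run) auto
  also have "\<dots> = real (even_height_tree_count n k)"
  proof (cases k)
    case 0
    then show ?thesis using assms by (simp add: even_height_tree_count_def)
  next
    case (Suc j)
    have "(\<Sum>E\<in>?T. greedy_size_prob E (Suc j) ?V) =
        (\<Sum>E\<in>?T. \<Sum>v\<in>?V. greedy_size_prob E j (?V - {v} - {w \<in> ?V - {v}. (v, w) \<in> E})) / real n"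
      by (simp add: sum_divide_distrib)
    also have "(\<Sum>E\<in>?T. \<Sum>v\<in>?V. greedy_size_prob E j (?V - {v} - {w \<in> ?V - {v}. (v, w) \<in> E})) =
        (\<Sum>v\<in>?V. \<Sum>E\<in>?T. greedy_size_prob E j (?V - {v} - {w \<in> ?V - {v}. (v, w) \<in> E}))"
      by (rule sum.swap)
    also have "\<dots> = (\<Sum>v\<in>?V. real (even_height_tree_count n (Suc j)))"
      unfolding cayley_trees_def using sum_trees_greedy[of ?V] by (intro sum.cong refl) simp
    finally show ?thesis using assms Suc by simp
  qed
  finally show ?thesis .
qed

lemma pmf_H_law:
  assumes "n \<ge> 1"
  shows "pmf (H_law n) k = real (even_height_tree_count n k) / real (card (cayley_trees n))"
proof -
  let ?T = "cayley_trees n" and ?V = "{1..n}"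
  let ?e = "\<lambda>E r. card {v \<in> ?V. even (graph_dist E r v)}"
  have T: "?T \<noteq> {}" "finite ?T" using cayley_trees_nonempty[OF assms] finite_cayley_trees by auto
  have V: "?V \<noteq> {}" "finite ?V" using assms by auto
  have "H_law n = pmf_of_set ?V \<bind> (\<lambda>r. pmf_of_set ?T \<bind> (\<lambda>E. return_pmf (?e E r)))"
    unfolding H_law_def random_rooted_cayley_tree_def random_cayley_tree_def pair_pmf_def map_bind_pmf
    by (subst bind_commute_pmf) simp
  then have "pmf (H_law n) k =
      (\<Sum>r\<in>?V. (\<Sum>E\<in>?T. of_bool (?e E r = k)) / real (card ?T)) / real (card ?V)"
    using T V by (simp add: pmf_bind_pmf_of_set pmf_return indicator_def of_bool_def if_distrib cong: if_cong)
  also have "(\<Sum>E\<in>?T. of_bool (?e E r = k) :: real) = real (even_height_tree_count n k)" if "r \<in> ?V" for r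
  proof -
    have "(\<Sum>E\<in>?T. of_bool (?e E r = k) :: real) = real (card {E \<in> ?T. ?e E r = k})"
      using T(2) by (simp add: Int_def)
    then show ?thesis using card_trees_even_dist[OF V(2) that, of k] by (simp add: cayley_trees_def)
  qed
  then have "(\<Sum>r\<in>?V. (\<Sum>E\<in>?T. of_bool (?e E r = k)) / real (card ?T)) / real (card ?V) =
      real (even_height_tree_count n k) / real (card ?T)"
    using assms by simp
  finally show ?thesis .
qed

theorem theorem1:
  fixes n :: nat
  assumes "n \<ge> 1"
  shows "G_law n = H_law n \<and>
    (\<forall>k. 1 \<le> k \<and> k \<le> n - 1 \<longrightarrow>
      pmf (G_law n) k = pmf (H_law n) k \<and>
      pmf (H_law n) k =
        real (n choose k) * (real k ^ (n - k) * real (n - k) ^ (k - 1) / real n ^ (n - 1)))"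
proof (intro conjI allI impI)
  show eq: "G_law n = H_law n"
    by (rule pmf_eqI) (simp only: pmf_G_law[OF assms] pmf_H_law[OF assms])
  fix k :: nat assume k: "1 \<le> k \<and> k \<le> n - 1"
  show "pmf (G_law n) k = pmf (H_law n) k" by (simp add: eq)
  define m where "m = n - k"
  have n2: "n \<ge> 2" using k by arith
  have m: "m \<ge> 1" "n = k + m" using k by (auto simp: m_def)
  have "n * ((n - 1) choose (k - 1)) = k * (n choose k)"
    using k times_binomial_minus1_eq[of k n] by simp
  moreover have "(n - 1) choose m = (n - 1) choose (k - 1)"
    using k m by (subst binomial_symmetric) auto
  ultimately have c: "real n * real ((n - 1) choose m) = real k * real (n choose k)"
    by (metis of_nat_mult)
  have "even_height_tree_count n k = ((n - 1) choose m) * k ^ (m - 1) * m ^ (k - 1)"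
    using k m by (auto simp: even_height_tree_count_def forest_number_def)
  then have "pmf (H_law n) k = real ((n - 1) choose m) * real k ^ (m - 1) * real m ^ (k - 1) / real n ^ (n - 2)"
    using card_cayley_trees[OF n2] by (simp add: pmf_H_law[OF assms])
  also have "\<dots> = (real n * real ((n - 1) choose m)) * real k ^ (m - 1) * real m ^ (k - 1) / (real n * real n ^ (n - 2))"
    using n2 by simp
  also have "real n * real n ^ (n - 2) = real n ^ (n - 1)"
    using n2 by (simp flip: power_Suc add: Suc_diff_Suc numeral_2_eq_2)
  also have "(real n * real ((n - 1) choose m)) * real k ^ (m - 1) = real (n choose k) * (real k * real k ^ (m - 1))"
    unfolding c by simp
  also have "real k * real k ^ (m - 1) = real k ^ m" using m(1) by (cases m) auto
  finally show "pmf (H_law n) k =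
      real (n choose k) * (real k ^ (n - k) * real (n - k) ^ (k - 1) / real n ^ (n - 1))"
    by (simp add: m_def)
qed

end
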